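(* For every finite non-empty set $S$, the dual augmented poset ${}^{\mathrm{As}}\Pi^+(S)^{\mathrm{op}}$ admits a recursive atom ordering, and the poset ${}^{\mathrm{As}}\Pi^+(S)$ is therefore Cohen--Macaulay.
   Context: ${}^{\mathrm{As}}\Pi(S)$ is the poset of partitions of $S$ equipped with a linear order on the set of blocks (set compositions of $S$), where $x\le y$ iff $x$ is obtained from $y$ by merging blocks that are consecutive in the linear order (so the least element is the composition with one block, and the maximal elements are the linear orderings of $S$). ${}^{\mathrm{As}}\Pi^+(S)$ is obtained from it by adding a greatest element, and $(\cdot)^{\mathrm{op}}$ denotes the poset with reversed order. A bounded poset $P$ (with least element $\hat0$ and greatest element $\hat1$) admits a recursive atom ordering if it has only two elements $\hat0<\hat1$, or if it has at least three elements and there is an ordering $a_1,\dots,a_k$ of its atoms such that: (1) for all $j$, the interval $[a_j,\hat1]$ admits a recursive atom ordering in which the atoms of $[a_j,\hat1]$ that come first in the ordering are those covering some $a_i$ with $i<j$; (2) for all $i<j$, if $a_i,a_j<y$ then there are $l<j$ and an element $z$ such that $z$ covers both $a_l$ and $a_j$ and $z\le y$. A graded poset $P$ is Cohen--Macaulay (over a commutative ring $\mathbb{K}$) if for all $x\le y$ in $P$, $h_n([x,y])=0$ for $n$ different from the rank of $[x,y]$, where $h_n([x,y])$ is the $n$-th homology of the complex of chains $x=x_0<x_1<\cdots<x_n=y$ (for $n\ge2$ and $x<y$, equivalently the reduced homology $\widetilde{H}_{n-2}$ of the order complex of the open interval $(x,y)$). *)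

theory Defs
  imports
    "HOL-Library.Disjoint_Sets"
    "HOL-Library.Poly_Mapping"
    "HOL-Algebra.Elementary_Groups"
begin

text \<open>A poset is a relation \<open>r\<close> with \<^term>\<open>Partial_order r\<close>: its elements are those of \<^term>\<open>Field r\<close>,
  and \<open>(x, y) \<in> r\<close> means \<open>x \<le> y\<close>. The opposite poset is \<^term>\<open>converse r\<close>.\<close>

definition least_elem :: "'b rel \<Rightarrow> 'b \<Rightarrow> bool" where
  "least_elem r b \<longleftrightarrow> b \<in> Field r \<and> (\<forall>x\<in>Field r. (b, x) \<in> r)"

definition greatest_elem :: "'b rel \<Rightarrow> 'b \<Rightarrow> bool" where
  "greatest_elem r t \<longleftrightarrow> t \<in> Field r \<and> (\<forall>x\<in>Field r. (x, t) \<in> r)"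

definition strictly_below :: "'b rel \<Rightarrow> 'b \<Rightarrow> 'b \<Rightarrow> bool" where
  "strictly_below r x y \<longleftrightarrow> (x, y) \<in> r \<and> x \<noteq> y"

definition covered_by :: "'b rel \<Rightarrow> 'b \<Rightarrow> 'b \<Rightarrow> bool" where
  "covered_by r x y \<longleftrightarrow> strictly_below r x y \<and> (\<nexists>z. strictly_below r x z \<and> strictly_below r z y)"

definition closed_interval :: "'b rel \<Rightarrow> 'b \<Rightarrow> 'b \<Rightarrow> 'b rel" where
  "closed_interval r x y = Restr r {z. (x, z) \<in> r \<and> (z, y) \<in> r}"


text \<open>\<open>recursive_atom_ordering r as\<close>: the poset \<open>r\<close> is bounded and the list \<open>as\<close> of its atoms is a
  recursive atom ordering. In a two-element poset the only atom is the greatest element.\<close>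

inductive recursive_atom_ordering :: "'b rel \<Rightarrow> 'b list \<Rightarrow> bool" where
  two_elements:
    "\<lbrakk>Partial_order r; least_elem r b; greatest_elem r t; b \<noteq> t; Field r = {b, t}\<rbrakk>
     \<Longrightarrow> recursive_atom_ordering r [t]"
| at_least_three_elements:
    "\<lbrakk>Partial_order r; least_elem r b; greatest_elem r t; \<exists>x\<in>Field r. x \<noteq> b \<and> x \<noteq> t; b \<noteq> t;
      distinct as; set as = {a. covered_by r b a};
      \<forall>j<length as. \<exists>bs. recursive_atom_ordering (closed_interval r (as ! j) t) bs \<and>
        (\<exists>m. set (take m bs) = {c \<in> set bs. \<exists>i<j. covered_by r (as ! i) c});
      \<forall>j<length as. \<forall>i<j. \<forall>y. strictly_below r (as ! i) y \<and> strictly_below r (as ! j) y \<longrightarrow>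
        (\<exists>l<j. \<exists>z. covered_by r (as ! l) z \<and> covered_by r (as ! j) z \<and> (z, y) \<in> r)\<rbrakk>
     \<Longrightarrow> recursive_atom_ordering r as"

definition admits_recursive_atom_ordering :: "'b rel \<Rightarrow> bool" where
  "admits_recursive_atom_ordering r \<longleftrightarrow> (\<exists>as. recursive_atom_ordering r as)"


definition maximal_chains :: "'b rel \<Rightarrow> 'b set set" where
  "maximal_chains r = {C \<in> Chains r. \<forall>D\<in>Chains r. C \<subseteq> D \<longrightarrow> D = C}"

text \<open>Every poset has a maximal chain, so the rank is unique if it exists.\<close>

definition has_rank :: "'b rel \<Rightarrow> nat \<Rightarrow> bool" where
  "has_rank r n \<longleftrightarrow> (\<forall>C\<in>maximal_chains r. finite C \<and> card C = Suc n)"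

definition graded_poset :: "'b rel \<Rightarrow> bool" where
  "graded_poset r \<longleftrightarrow> Partial_order r \<and> (\<forall>(x, y)\<in>r. \<exists>n. has_rank (closed_interval r x y) n)"


text \<open>The chains \<open>x = x\<^sub>0 < x\<^sub>1 < \<dots> < x\<^sub>n = y\<close>, as lists of length \<open>n + 1\<close>.\<close>

definition strict_chains :: "'b rel \<Rightarrow> 'b \<Rightarrow> 'b \<Rightarrow> nat \<Rightarrow> 'b list set" where
  "strict_chains r x y n =
     {xs. length xs = Suc n \<and> hd xs = x \<and> last xs = y \<and> set xs \<subseteq> Field r \<and>
          sorted_wrt (strictly_below r) xs}"

text \<open>The free module on these chains is the set of finitely supported functions with support in
  \<^term>\<open>strict_chains r x y n\<close>.\<close>

definition chain_module :: "'b rel \<Rightarrow> 'b \<Rightarrow> 'b \<Rightarrow> nat \<Rightarrow> ('b list \<Rightarrow>\<^sub>0 'k::comm_ring_1) set" where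
  "chain_module r x y n = {c. Poly_Mapping.keys c \<subseteq> strict_chains r x y n}"

text \<open>The linear map sending \<open>x\<^sub>0 < \<dots> < x\<^sub>n\<close> to the alternating sum of the chains obtained by deleting
  \<open>x\<^sub>i\<close> for \<open>0 < i < n\<close>; the two endpoints are never deleted.\<close>

definition chain_boundary :: "('b list \<Rightarrow>\<^sub>0 'k::comm_ring_1) \<Rightarrow> ('b list \<Rightarrow>\<^sub>0 'k)" where
  "chain_boundary c =
     (\<Sum>xs\<in>Poly_Mapping.keys c. \<Sum>i\<in>{1..<length xs - 1}.
        Poly_Mapping.single (take i xs @ drop (Suc i) xs) ((- 1) ^ i * Poly_Mapping.lookup c xs))"

definition chain_cycles :: "'b rel \<Rightarrow> 'b \<Rightarrow> 'b \<Rightarrow> nat \<Rightarrow> ('b list \<Rightarrow>\<^sub>0 'k::comm_ring_1) set" where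
  "chain_cycles r x y n = {c \<in> chain_module r x y n. chain_boundary c = 0}"

definition chain_boundaries :: "'b rel \<Rightarrow> 'b \<Rightarrow> 'b \<Rightarrow> nat \<Rightarrow> ('b list \<Rightarrow>\<^sub>0 'k::comm_ring_1) set" where
  "chain_boundaries r x y n = chain_boundary ` chain_module r x y (Suc n)"

text \<open>The underlying abelian group of the homology module \<open>h\<^sub>n([x, y])\<close>, in multiplicative notation.\<close>

definition interval_homology ::
    "'b rel \<Rightarrow> 'b \<Rightarrow> 'b \<Rightarrow> nat \<Rightarrow> ('b list \<Rightarrow>\<^sub>0 'k::comm_ring_1) set monoid" where
  "interval_homology r x y n =
     \<lparr>carrier = chain_cycles r x y n, monoid.mult = (+), one = 0\<rparr> Mod chain_boundaries r x y n"

text \<open>The ring of coefficients is the type \<open>'k\<close>.\<close>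

definition cohen_macaulay :: "'k::comm_ring_1 itself \<Rightarrow> 'b rel \<Rightarrow> bool" where
  "cohen_macaulay K r \<longleftrightarrow> graded_poset r \<and>
     (\<forall>(x, y)\<in>r. \<forall>d n. has_rank (closed_interval r x y) d \<and> n \<noteq> d \<longrightarrow>
        trivial_group (interval_homology r x y n :: ('b list \<Rightarrow>\<^sub>0 'k) set monoid))"


text \<open>A partition with a linear order on its blocks is the list of its blocks in increasing order.\<close>

definition set_compositions :: "'a set \<Rightarrow> 'a set list set" where
  "set_compositions S = {p. distinct p \<and> partition_on S (set p)}"

text \<open>The list \<open>q\<close> is cut into nonempty segments of consecutive blocks, and each segment is replaced
  by its union.\<close>

definition merges_to :: "'a set list \<Rightarrow> 'a set list \<Rightarrow> bool" where
  "merges_to q p \<longleftrightarrow>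
     (\<exists>gs. [] \<notin> set gs \<and> concat gs = q \<and> p = map (\<lambda>g. \<Union>(set g)) gs)"

definition AsPi :: "'a set \<Rightarrow> 'a set list rel" where
  "AsPi S = {(p, q). p \<in> set_compositions S \<and> q \<in> set_compositions S \<and> merges_to q p}"

definition add_greatest :: "'b rel \<Rightarrow> 'b option rel" where
  "add_greatest r =
     {(Some x, Some y) | x y. (x, y) \<in> r} \<union> {(z, None) | z. z \<in> insert None (Some ` Field r)}"

definition AsPi_plus :: "'a set \<Rightarrow> 'a set list option rel" where
  "AsPi_plus S = add_greatest (AsPi S)"

end

theory Submission
  imports Defs "HOL.Modules" "HOL-Library.List_Lexorder"
begin

text \<open>A set composition is determined by the flag of the unions of its proper initial segments, and merging
  consecutive blocks removes members of the flag. So the poset is the face poset of the order complex of the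
  proper nonempty subsets of \<open>S\<close>. Its facets are the linear orderings of \<open>S\<close>, and listing them
  lexicographically is a shelling, that is, a recursive atom ordering of the dual: all intervals above an
  atom are Boolean, so that any ordering of their atoms is recursive.

  A recursive atom ordering \<open>a\<^sub>1, \<dots>, a\<^sub>k\<close> of a poset with a rank function makes the homology below the top
  degree vanish: the chains of elements above some \<open>a\<^sub>i\<close> with \<open>i \<le> m\<close> are glued from those for \<open>i < m\<close> and
  the cone of chains above \<open>a\<^sub>m\<close>, along the chains of elements above one of the first atoms of
  \<open>[a\<^sub>m, 1]\<close>, to which induction applies.\<close>

section \<open>The chain complex without the fixed last element\<close>

text \<open>Cohen--Macaulayness concerns every interval, whereas a recursive atom ordering only
  speaks of intervals that reach the top. Upper intervals inherit such an ordering from the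
  recursion, but lower ones do not come with any. The vanishing is therefore proved for chains
  hanging from an arbitrary element \<open>x\<close>: everything below \<open>x\<close> is used,
  \<open>x\<close> stays fixed throughout the recursion, and intervals \<open>[y, x]\<close> need no
  atom ordering of their own.

  Chains are descending lists with head \<open>x\<close>, because the target is the dual of the
  poset that carries the ordering. The other end \<open>y\<close> of the interval is left out: then
  the last entry varies freely, which permits coning and splitting by upward closed sets, and
  \<open>y\<close> is appended again only when the result is compared with the given complex.

  Degrees above the rank need no topology, since no chains of that length exist. Only degrees below
  the rank are handled by gluing.\<close>

definition additive_ext :: "('b \<Rightarrow> 'k \<Rightarrow> 'm) \<Rightarrow> ('b \<Rightarrow>\<^sub>0 'k::zero) \<Rightarrow> 'm::comm_monoid_add" where
  "additive_ext f c = (\<Sum>x\<in>Poly_Mapping.keys c. f x (Poly_Mapping.lookup c x))"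

lemma additive_ext_superset:
  assumes "\<And>x. f x 0 = 0" "finite A" "Poly_Mapping.keys c \<subseteq> A"
  shows "additive_ext f c = (\<Sum>x\<in>A. f x (Poly_Mapping.lookup c x))"
  unfolding additive_ext_def
  by (rule sum.mono_neutral_left) (use assms in \<open>auto simp: in_keys_iff\<close>)

lemma additive_additive_ext:
  fixes f :: "'b \<Rightarrow> 'k::ab_group_add \<Rightarrow> 'm::ab_group_add"
  assumes f: "\<And>x. additive (f x)"
  shows "additive (additive_ext f)"
proof
  fix c d :: "'b \<Rightarrow>\<^sub>0 'k"
  let ?A = "Poly_Mapping.keys c \<union> Poly_Mapping.keys d"
  have "additive_ext f e = (\<Sum>x\<in>?A. f x (Poly_Mapping.lookup e x))"
    if "Poly_Mapping.keys e \<subseteq> ?A" for e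
    using that by (intro additive_ext_superset) (auto simp: additive.zero[OF f])
  moreover have "Poly_Mapping.keys (c + d) \<subseteq> ?A"
    by (rule Poly_Mapping.keys_add)
  ultimately show "additive_ext f (c + d) = additive_ext f c + additive_ext f d"
    by (simp add: lookup_add additive.add[OF f] sum.distrib)
qed

lemma additive_ext_single [simp]:
  "f x 0 = 0 \<Longrightarrow> additive_ext f (Poly_Mapping.single x k) = f x k"
  by (cases "k = 0") (simp_all add: additive_ext_def)

lemma keys_additive_ext_subset:
  assumes "Poly_Mapping.keys c \<subseteq> A" "\<And>x k. x \<in> A \<Longrightarrow> Poly_Mapping.keys (f x k) \<subseteq> B"
  shows "Poly_Mapping.keys (additive_ext f c) \<subseteq> B"
  unfolding additive_ext_def
  using keys_sum[of "\<lambda>x. f x (Poly_Mapping.lookup c x)" "Poly_Mapping.keys c"] assms by blast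

lemma poly_mapping_sum_single:
  fixes c :: "'b \<Rightarrow>\<^sub>0 'k::comm_monoid_add"
  shows "c = (\<Sum>x\<in>Poly_Mapping.keys c. Poly_Mapping.single x (Poly_Mapping.lookup c x))"
proof (rule poly_mapping_eqI)
  fix y
  have "(\<Sum>x\<in>Poly_Mapping.keys c. Poly_Mapping.lookup (Poly_Mapping.single x (Poly_Mapping.lookup c x)) y)
     = (\<Sum>x\<in>Poly_Mapping.keys c. if x = y then Poly_Mapping.lookup c y else 0)"
    by (rule sum.cong) (auto simp: lookup_single when_def)
  also have "\<dots> = Poly_Mapping.lookup c y"
    by (simp add: in_keys_iff)
  finally show "Poly_Mapping.lookup c y = Poly_Mapping.lookup
      (\<Sum>x\<in>Poly_Mapping.keys c. Poly_Mapping.single x (Poly_Mapping.lookup c x)) y"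
    by (simp add: lookup_sum)
qed

text \<open>A finitely supported function is the sum of its monomials, so identities between
  operators are checked on single lists. The maps are additive and not assumed linear, hence the
  coefficient \<open>k\<close> varies together with \<open>x\<close>; additivity suffices because
  homology is taken as an abelian group.\<close>

lemma additive_eq_on_keys:
  fixes F G :: "('b \<Rightarrow>\<^sub>0 'k::ab_group_add) \<Rightarrow> 'm::ab_group_add"
  assumes "additive F" "additive G" "Poly_Mapping.keys c \<subseteq> A"
    and "\<And>x k. x \<in> A \<Longrightarrow> F (Poly_Mapping.single x k) = G (Poly_Mapping.single x k)"
  shows "F c = G c"
proof -
  have "F (\<Sum>x\<in>Poly_Mapping.keys c. Poly_Mapping.single x (Poly_Mapping.lookup c x)) =
        G (\<Sum>x\<in>Poly_Mapping.keys c. Poly_Mapping.single x (Poly_Mapping.lookup c x))"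
    unfolding additive.sum[OF assms(1)] additive.sum[OF assms(2)]
    by (rule sum.cong) (use assms in auto)
  then show ?thesis
    by (simp flip: poly_mapping_sum_single)
qed

lemma additive_compose: "additive F \<Longrightarrow> additive G \<Longrightarrow> additive (\<lambda>c. F (G c))"
  by (simp add: additive_def)

lemma additive_plus: "additive F \<Longrightarrow> additive G \<Longrightarrow> additive (\<lambda>c. F c + G c)"
  by (simp add: additive_def)

lemma additive_single: "additive (Poly_Mapping.single x)"
  by (simp add: additive_def single_add)

section \<open>Signs, boundary and cone operators\<close>

definition alternate :: "nat \<Rightarrow> 'm::ab_group_add \<Rightarrow> 'm" where
  "alternate m c = (if even m then c else - c)"

lemma additive_alternate: "additive (alternate m)"
  by (simp add: additive_def alternate_def)

lemma alternate_Suc: "alternate (Suc m) c = - alternate m c"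
  by (simp add: alternate_def)

lemma alternate_alternate [simp]: "alternate m (alternate m c) = c"
  by (simp add: alternate_def)

lemma alternate_commute: "additive F \<Longrightarrow> F (alternate m c) = alternate m (F c)"
  by (simp add: alternate_def additive.minus)

lemma keys_alternate [simp]: "Poly_Mapping.keys (alternate m c) = Poly_Mapping.keys c"
  by (simp add: alternate_def)

lemma alternate_single:
  "alternate m (Poly_Mapping.single x (k::'k::comm_ring_1)) = Poly_Mapping.single x ((- 1) ^ m * k)"
  by (simp add: alternate_def single_uminus)

text \<open>On descending lists this is the augmented simplicial boundary of the order complex below
  the head: the head is never deleted, and the list consisting of the head alone plays the empty
  simplex.\<close>

definition tail_boundary :: "('b list \<Rightarrow>\<^sub>0 'k::comm_ring_1) \<Rightarrow> ('b list \<Rightarrow>\<^sub>0 'k)" where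
  "tail_boundary = additive_ext (\<lambda>xs k. \<Sum>i\<in>{1..<length xs}.
     Poly_Mapping.single (take i xs @ drop (Suc i) xs) ((- 1) ^ i * k))"

definition append_last :: "'b \<Rightarrow> ('b list \<Rightarrow>\<^sub>0 'k::comm_ring_1) \<Rightarrow> ('b list \<Rightarrow>\<^sub>0 'k)" where
  "append_last a = additive_ext (\<lambda>xs. Poly_Mapping.single (xs @ [a]))"

text \<open>The join with an apex \<open>a\<close>. A list already containing \<open>a\<close> goes
  to 0, since otherwise a vertex would be repeated.\<close>

definition cone_op :: "'b \<Rightarrow> ('b list \<Rightarrow>\<^sub>0 'k::comm_ring_1) \<Rightarrow> ('b list \<Rightarrow>\<^sub>0 'k)" where
  "cone_op a = additive_ext (\<lambda>xs k. if a \<in> set xs then 0 else Poly_Mapping.single (xs @ [a]) k)"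

lemma additive_tail_boundary: "additive tail_boundary"
  unfolding tail_boundary_def
  by (rule additive_additive_ext) (simp add: additive_def distrib_left single_add sum.distrib)

lemma additive_append_last: "additive (append_last a)"
  unfolding append_last_def by (rule additive_additive_ext) (rule additive_single)

lemma additive_cone_op: "additive (cone_op a)"
  unfolding cone_op_def by (rule additive_additive_ext) (simp add: additive_def single_add)

lemma additive_chain_boundary:
  "additive (chain_boundary :: ('b list \<Rightarrow>\<^sub>0 'k::comm_ring_1) \<Rightarrow> _)"
proof -
  have eq: "chain_boundary = additive_ext (\<lambda>(xs::'b list) (k::'k). \<Sum>i\<in>{1..<length xs - 1}.
     Poly_Mapping.single (take i xs @ drop (Suc i) xs) ((- 1) ^ i * k))"
    by (simp add: fun_eq_iff chain_boundary_def additive_ext_def)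
  show ?thesis
    unfolding eq
    by (rule additive_additive_ext) (simp add: additive_def distrib_left single_add sum.distrib)
qed

lemma additive_zero: "additive (\<lambda>_. 0)"
  by (simp add: additive_def)

lemmas additive_compositions =
  additive_compose[OF additive_tail_boundary additive_tail_boundary]
  additive_compose[OF additive_tail_boundary additive_append_last]
  additive_compose[OF additive_tail_boundary additive_cone_op]
  additive_compose[OF additive_append_last additive_tail_boundary]
  additive_compose[OF additive_cone_op additive_tail_boundary]
  additive_compose[OF additive_cone_op additive_append_last]
  additive_compose[OF additive_chain_boundary additive_append_last]

lemmas additive_intros = additive_tail_boundary additive_append_last additive_cone_op
  additive_chain_boundary additive_alternate additive_compositions additive_plus additive_zero

lemma tail_boundary_single: "tail_boundary (Poly_Mapping.single xs k) =
    (\<Sum>i\<in>{1..<length xs}. Poly_Mapping.single (take i xs @ drop (Suc i) xs) ((- 1) ^ i * k))"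
  unfolding tail_boundary_def by (rule additive_ext_single) simp

lemma append_last_single [simp]:
  "append_last a (Poly_Mapping.single xs k) = Poly_Mapping.single (xs @ [a]) k"
  unfolding append_last_def by (rule additive_ext_single) simp

lemma cone_op_single: "cone_op a (Poly_Mapping.single xs k) =
    (if a \<in> set xs then 0 else Poly_Mapping.single (xs @ [a]) k)"
  unfolding cone_op_def by (rule additive_ext_single) simp

lemma chain_boundary_single: "chain_boundary (Poly_Mapping.single xs k) =
    (\<Sum>i\<in>{1..<length xs - 1}. Poly_Mapping.single (take i xs @ drop (Suc i) xs) ((- 1) ^ i * k))"
  by (cases "k = 0") (simp_all add: chain_boundary_def)

lemma tail_boundary_single_Nil [simp]: "tail_boundary (Poly_Mapping.single [] k) = 0"
  and tail_boundary_single_Cons_Nil [simp]: "tail_boundary (Poly_Mapping.single [a] k) = 0"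
  by (simp_all add: tail_boundary_single)

lemma append_last_tail_boundary_single:
  "append_last a (tail_boundary (Poly_Mapping.single xs k)) =
     (\<Sum>i\<in>{1..<length xs}.
        Poly_Mapping.single (take i (xs @ [a]) @ drop (Suc i) (xs @ [a])) ((- 1) ^ i * k))"
  unfolding tail_boundary_single additive.sum[OF additive_append_last]
  by (rule sum.cong) auto

text \<open>Deleting the last entry is split off from the other deletions; the later computations
  recurse on the right end through this identity. With \<open>xs\<close> empty, the last entry would
  be the protected head.\<close>

lemma tail_boundary_single_snoc:
  assumes "xs \<noteq> []"
  shows "tail_boundary (Poly_Mapping.single (xs @ [a]) k) =
    append_last a (tail_boundary (Poly_Mapping.single xs k))
    + alternate (length xs) (Poly_Mapping.single xs k)"
proof -
  have "{1..<length (xs @ [a])} = insert (length xs) {1..<length xs}"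
    using assms by (auto simp: Suc_le_eq)
  then show ?thesis
    unfolding append_last_tail_boundary_single tail_boundary_single[of "xs @ [a]"]
    by (simp add: alternate_single add.commute)
qed

lemma tail_boundary_append_last:
  assumes "Poly_Mapping.keys c \<subseteq> {xs. length xs = m}" "0 < m"
  shows "tail_boundary (append_last a c) =
    append_last a (tail_boundary c) + alternate m c"
  by (rule additive_eq_on_keys[OF _ _ assms(1)])
    (use \<open>0 < m\<close> in \<open>auto intro!: additive_intros simp: tail_boundary_single_snoc\<close>)

text \<open>\<open>chain_boundary\<close> protects both ends and \<open>tail_boundary\<close> only
  the first. Once \<open>b\<close> is appended, the deleted positions are the same.\<close>

lemma chain_boundary_append_last:
  "chain_boundary (append_last b c) = append_last b (tail_boundary c)"
  by (rule additive_eq_on_keys[where A = UNIV])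
    (auto intro!: additive_intros simp: append_last_tail_boundary_single chain_boundary_single)

lemma keys_tail_boundary_length:
  assumes "Poly_Mapping.keys c \<subseteq> {xs. length xs = m}"
  shows "Poly_Mapping.keys (tail_boundary c) \<subseteq> {xs. length xs = m - 1}"
  unfolding tail_boundary_def
proof (rule keys_additive_ext_subset[OF assms])
  fix xs :: "'a list" and k :: 'b
  assume "xs \<in> {xs. length xs = m}"
  then show "Poly_Mapping.keys (\<Sum>i\<in>{1..<length xs}.
      Poly_Mapping.single (take i xs @ drop (Suc i) xs) ((- 1) ^ i * k)) \<subseteq> {xs. length xs = m - 1}"
    by (intro order.trans[OF keys_sum]) auto
qed

text \<open>Splitting off the last entry twice produces the boundary of \<open>xs\<close> with two
  opposite signs. Lists \<open>xs\<close> of length 1 are separate, because their boundary is 0 and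
  the second splitting needs nonempty lists.\<close>

lemma tail_boundary_tail_boundary [simp]: "tail_boundary (tail_boundary c) = 0"
proof -
  have single: "tail_boundary (tail_boundary (Poly_Mapping.single xs k)) = 0"
    for xs :: "'a list" and k :: 'b
  proof (induction xs rule: rev_induct)
    case Nil
    then show ?case by (simp add: additive.zero[OF additive_tail_boundary])
  next
    case (snoc a xs)
    consider "xs = []" | b where "xs = [b]" | "2 \<le> length xs"
      by (cases xs; cases "tl xs") auto
    then show ?case
    proof cases
      case 2
      have "tail_boundary (Poly_Mapping.single [b, a] k) = alternate 1 (Poly_Mapping.single [b] k)"
        using tail_boundary_single_snoc[of "[b]" a k]
        by (simp add: additive.zero[OF additive_append_last])
      then show ?thesis
        using 2 by (simp add: alternate_commute[OF additive_tail_boundary]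
            additive.zero[OF additive_alternate])
    next
      case 3
      let ?d = "tail_boundary (Poly_Mapping.single xs k)"
      have keys: "Poly_Mapping.keys ?d \<subseteq> {ys. length ys = length xs - 1}"
        by (rule keys_tail_boundary_length) simp
      have "tail_boundary (append_last a ?d) = alternate (length xs - 1) ?d"
        using tail_boundary_append_last[OF keys] 3 snoc.IH
        by (simp add: additive.zero[OF additive_append_last])
      also have "\<dots> = - alternate (length xs) ?d"
        using 3 by (cases "length xs") (simp_all add: alternate_Suc)
      finally have "tail_boundary (append_last a ?d) = - alternate (length xs) ?d" .
      moreover have "xs \<noteq> []"
        using 3 by auto
      ultimately show ?thesis
        by (simp add: tail_boundary_single_snoc additive.add[OF additive_tail_boundary]
            alternate_commute[OF additive_tail_boundary])
    qed (simp add: additive.zero[OF additive_tail_boundary])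
  qed
  show ?thesis
    by (rule additive_eq_on_keys[where A = UNIV and G = "\<lambda>_. 0"])
      (auto intro!: additive_intros simp: single)
qed

text \<open>The homotopy identity of a cone. When \<open>xs\<close> ends in \<open>a\<close>, the
  left side vanishes, and coning the face without \<open>a\<close> gives back \<open>xs\<close> with
  the sign opposite to \<open>alternate m\<close>. The condition \<open>1 < m\<close> keeps that
  face nonempty, so that \<open>a\<close> is not the head.\<close>

lemma tail_boundary_cone_op:
  assumes "Poly_Mapping.keys c \<subseteq>
    {xs. length xs = m \<and> (a \<in> set xs \<longrightarrow> a \<notin> set (butlast xs) \<and> last xs = a \<and> 1 < m)}" "0 < m"
  shows "tail_boundary (cone_op a c) = cone_op a (tail_boundary c) + alternate m c"
proof (rule additive_eq_on_keys[OF _ _ assms(1)])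
  fix xs :: "'a list" and k :: 'b
  have cone: "cone_op a d = append_last a d" if "Poly_Mapping.keys d \<subseteq> {xs. a \<notin> set xs}" for d :: "'a list \<Rightarrow>\<^sub>0 'b"
    by (rule additive_eq_on_keys[OF _ _ that]) (auto intro!: additive_intros simp: cone_op_single)
  have cone_append: "cone_op a (append_last a d) = 0" for d :: "'a list \<Rightarrow>\<^sub>0 'b"
    by (rule additive_eq_on_keys[where A = UNIV and G = "\<lambda>_. 0"])
      (auto intro!: additive_intros simp: cone_op_single)
  assume "xs \<in> {xs. length xs = m \<and> (a \<in> set xs \<longrightarrow> a \<notin> set (butlast xs) \<and> last xs = a \<and> 1 < m)}"
  then have m: "length xs = m" and a: "a \<in> set xs \<Longrightarrow> a \<notin> set (butlast xs) \<and> last xs = a \<and> 1 < m"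
    by auto
  have "xs \<noteq> []" using m \<open>0 < m\<close> by auto
  show "tail_boundary (cone_op a (Poly_Mapping.single xs k)) =
    cone_op a (tail_boundary (Poly_Mapping.single xs k)) + alternate m (Poly_Mapping.single xs k)"
  proof (cases "a \<in> set xs")
    case False
    have "Poly_Mapping.keys (tail_boundary (Poly_Mapping.single xs k)) \<subseteq> {xs. a \<notin> set xs}"
      unfolding tail_boundary_single
      by (rule order.trans[OF keys_sum]) (use False in \<open>auto dest: in_set_takeD in_set_dropD\<close>)
    then show ?thesis
      using False m \<open>xs \<noteq> []\<close> by (simp add: cone_op_single tail_boundary_single_snoc cone)
  next
    case True
    then obtain ys where xs: "xs = ys @ [a]" "a \<notin> set ys" "ys \<noteq> []"
      using a m \<open>xs \<noteq> []\<close> by (cases xs rule: rev_cases) auto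
    then have "m = Suc (length ys)"
      using m by simp
    then show ?thesis
      using xs by (simp add: tail_boundary_single_snoc additive.add[OF additive_cone_op] cone_append
          alternate_commute[OF additive_cone_op] cone_op_single alternate_Suc
          additive.zero[OF additive_tail_boundary])
  qed
qed (auto intro!: additive_intros)

section \<open>Recursive atom orderings and descending chains\<close>

lemma Partial_orderD:
  assumes "Partial_order r"
  shows "x \<in> Field r \<Longrightarrow> (x, x) \<in> r"
    and "(x, y) \<in> r \<Longrightarrow> (y, z) \<in> r \<Longrightarrow> (x, z) \<in> r"
    and "(x, y) \<in> r \<Longrightarrow> (y, x) \<in> r \<Longrightarrow> x = y"
  using assms unfolding order_on_defs by (auto dest: refl_onD transD antisymD)

lemma closed_interval_iff:
  "(u, v) \<in> closed_interval r x y \<longleftrightarrow>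
     (u, v) \<in> r \<and> (x, u) \<in> r \<and> (u, y) \<in> r \<and> (x, v) \<in> r \<and> (v, y) \<in> r"
  by (auto simp: closed_interval_def)

lemma Field_closed_interval:
  assumes "Partial_order r"
  shows "Field (closed_interval r x y) = {z. (x, z) \<in> r \<and> (z, y) \<in> r}"
proof (intro equalityI subsetI)
  fix z assume z: "z \<in> {z. (x, z) \<in> r \<and> (z, y) \<in> r}"
  then have "(z, z) \<in> closed_interval r x y"
    using Partial_orderD(1)[OF assms] by (auto simp: closed_interval_iff FieldI1)
  then show "z \<in> Field (closed_interval r x y)"
    by (rule FieldI1)
qed (auto simp: Field_def closed_interval_iff)

lemma Partial_order_closed_interval:
  assumes "Partial_order r"
  shows "Partial_order (closed_interval r x y)"
  unfolding partial_order_on_def preorder_on_def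
proof (intro conjI)
  show "Refl (closed_interval r x y)"
    unfolding refl_on_def Field_closed_interval[OF assms]
    using Partial_orderD(1)[OF assms] by (auto simp: closed_interval_iff Field_def)
  show "trans (closed_interval r x y)"
    by (rule transI) (auto simp: closed_interval_iff intro: Partial_orderD(2)[OF assms])
  show "antisym (closed_interval r x y)"
    by (rule antisymI) (auto simp: closed_interval_iff intro: Partial_orderD(3)[OF assms])
  show "closed_interval r x y \<subseteq> Field (closed_interval r x y) \<times> Field (closed_interval r x y)"
    by (auto simp: Field_def)
qed

lemma strictly_below_closed_interval:
  "strictly_below (closed_interval r x y) u v \<longleftrightarrow>
     strictly_below r u v \<and> (x, u) \<in> r \<and> (u, y) \<in> r \<and> (x, v) \<in> r \<and> (v, y) \<in> r"
  by (auto simp: strictly_below_def closed_interval_iff)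

text \<open>Intervals are convex: whatever separates two of their elements belongs to them as
  well.\<close>

lemma covered_by_closed_interval:
  assumes "Partial_order r"
  shows "covered_by (closed_interval r x y) u v \<longleftrightarrow> covered_by r u v \<and> (x, u) \<in> r \<and> (v, y) \<in> r"
  using Partial_orderD(2)[OF assms]
  unfolding covered_by_def strictly_below_closed_interval unfolding strictly_below_def by blast

lemma least_elem_closed_interval:
  assumes "Partial_order r" "(x, y) \<in> r"
  shows "least_elem (closed_interval r x y) x" "greatest_elem (closed_interval r x y) y"
  using Partial_orderD(1)[OF assms(1)] assms(2)
  unfolding least_elem_def greatest_elem_def Field_closed_interval[OF assms(1)]
  by (auto simp: closed_interval_iff FieldI1 FieldI2)

lemma closed_interval_closed_interval:
  assumes "Partial_order r" "(x, x') \<in> r" "(x', y) \<in> r"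
  shows "closed_interval (closed_interval r x y) x' y = closed_interval r x' y"
proof -
  have "(y, y) \<in> r"
    using assms by (auto intro: Partial_orderD(1) FieldI2)
  then show ?thesis
    by (intro equalityI subrelI; unfold closed_interval_iff)
      (use assms(2,3) Partial_orderD(2)[OF assms(1)] in blast)+
qed

lemma closed_interval_least_greatest:
  assumes "least_elem r b" "greatest_elem r t"
  shows "closed_interval r b t = r"
  using assms by (auto simp: closed_interval_iff least_elem_def greatest_elem_def FieldI1 FieldI2)

lemma least_elem_unique:
  "Partial_order r \<Longrightarrow> least_elem r b \<Longrightarrow> least_elem r b' \<Longrightarrow> b = b'"
  by (auto simp: least_elem_def dest: Partial_orderD(3))

lemma greatest_elem_unique:
  "Partial_order r \<Longrightarrow> greatest_elem r t \<Longrightarrow> greatest_elem r t' \<Longrightarrow> t = t'"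
  by (auto simp: greatest_elem_def dest: Partial_orderD(3))

lemma covered_byD: "covered_by r x y \<Longrightarrow> (x, y) \<in> r \<and> x \<noteq> y"
  by (simp add: covered_by_def strictly_below_def)

lemma covered_by_unfold:
  "covered_by r x y \<longleftrightarrow> (x, y) \<in> r \<and> x \<noteq> y \<and> (\<forall>z. (x, z) \<in> r \<and> (z, y) \<in> r \<longrightarrow> z = x \<or> z = y)"
  by (auto simp: covered_by_def strictly_below_def)

lemma recursive_atom_ordering_bounded:
  assumes "recursive_atom_ordering r as"
  obtains b t where "Partial_order r" "least_elem r b" "greatest_elem r t" "b \<noteq> t"
  using assms by (cases rule: recursive_atom_ordering.cases) auto

lemma set_recursive_atom_ordering:
  assumes "recursive_atom_ordering r as" "least_elem r b"
  shows "set as = {a. covered_by r b a}"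
  using assms(1)
proof (cases rule: recursive_atom_ordering.cases)
  case (two_elements b' t)
  have [simp]: "b' = b"
    using two_elements assms(2) by (blast intro: least_elem_unique)
  have "(b, t) \<in> r"
    using two_elements by (simp add: least_elem_def)
  moreover have "z = b \<or> z = t" if "(b, z) \<in> r" for z
    using two_elements FieldI2[OF that] by simp
  ultimately show ?thesis
    using two_elements by (auto simp: covered_by_unfold)
next
  case (at_least_three_elements b' t)
  then show ?thesis
    using least_elem_unique assms(2) by metis
qed

section \<open>Descending chains and their exactness\<close>

definition descending_chains :: "'b rel \<Rightarrow> 'b set \<Rightarrow> 'b \<Rightarrow> nat \<Rightarrow> 'b list set" where
  "descending_chains r U x n = {ys. length ys = n \<and> ys \<noteq> [] \<and> hd ys = x \<and> set ys \<subseteq> U \<and>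
     sorted_wrt (\<lambda>u v. strictly_below r v u) ys}"

text \<open>For \<open>x\<close> in \<open>U\<close> and positive \<open>n\<close>, this is the
  vanishing of reduced homology in degree \<open>n - 2\<close> of the order complex of the elements
  of \<open>U\<close> strictly below \<open>x\<close>: besides \<open>x\<close>, a list of length
  \<open>n\<close> has \<open>n - 1\<close> vertices.\<close>

definition chains_exact :: "'k::comm_ring_1 itself \<Rightarrow> 'b rel \<Rightarrow> 'b set \<Rightarrow> 'b \<Rightarrow> nat \<Rightarrow> bool" where
  "chains_exact K r U x n \<longleftrightarrow> (\<forall>c :: 'b list \<Rightarrow>\<^sub>0 'k.
     Poly_Mapping.keys c \<subseteq> descending_chains r U x n \<and> tail_boundary c = 0 \<longrightarrow>
     (\<exists>e. Poly_Mapping.keys e \<subseteq> descending_chains r U x (Suc n) \<and> tail_boundary e = c))"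

lemma descending_chain_le:
  assumes "Partial_order r" "x \<in> Field r" "ys \<in> descending_chains r U x n" "y \<in> set ys"
  shows "(y, x) \<in> r"
proof -
  obtain zs where "ys = x # zs"
    using assms(3) by (cases ys) (auto simp: descending_chains_def)
  then show ?thesis
    using assms Partial_orderD(1)[OF assms(1,2)]
    by (auto simp: descending_chains_def strictly_below_def)
qed

lemma descending_chain_last_le:
  assumes "ys \<in> descending_chains r U x n" "y \<in> set ys" "y \<noteq> last ys"
  shows "(last ys, y) \<in> r"
proof -
  have "ys = butlast ys @ [last ys]"
    using assms(1) by (simp add: descending_chains_def)
  moreover have "sorted_wrt (\<lambda>u v. strictly_below r v u) ys"
    using assms(1) by (simp add: descending_chains_def)
  ultimately have "sorted_wrt (\<lambda>u v. strictly_below r v u) (butlast ys @ [last ys])"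
    by simp
  moreover have "y \<in> set (butlast ys)"
    using assms by (metis \<open>ys = butlast ys @ [last ys]\<close> UnE empty_iff empty_set set_ConsD set_append)
  ultimately show ?thesis
    by (auto simp: sorted_wrt_append strictly_below_def)
qed

lemma descending_chains_mono: "U \<subseteq> V \<Longrightarrow> descending_chains r U x n \<subseteq> descending_chains r V x n"
  by (auto simp: descending_chains_def)

lemma descending_chains_Int:
  "descending_chains r U x n \<inter> descending_chains r V x n = descending_chains r (U \<inter> V) x n"
  by (auto simp: descending_chains_def)

lemma descending_chains_cong:
  assumes "Partial_order r" "x \<in> Field r" "\<And>z. (z, x) \<in> r \<Longrightarrow> z \<in> U \<longleftrightarrow> z \<in> V"
  shows "descending_chains r U x n = descending_chains r V x n"
  using descending_chain_le[OF assms(1,2)] assms(3)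
  by (auto simp: descending_chains_def) blast+

lemma descending_chains_closed_interval:
  assumes "U \<subseteq> {z. (a, z) \<in> r \<and> (z, t) \<in> r}"
  shows "descending_chains (closed_interval r a t) U x n = descending_chains r U x n"
proof -
  have "sorted_wrt (\<lambda>u v. strictly_below (closed_interval r a t) v u) ys \<longleftrightarrow>
        sorted_wrt (\<lambda>u v. strictly_below r v u) ys" if "set ys \<subseteq> U" for ys
    using assms that
    by (induction ys) (auto simp: strictly_below_closed_interval)
  then show ?thesis
    unfolding descending_chains_def by auto
qed

lemma descending_chains_Un:
  assumes "\<And>u v. u \<in> U \<Longrightarrow> (u, v) \<in> r \<Longrightarrow> v \<in> U" "\<And>u v. u \<in> V \<Longrightarrow> (u, v) \<in> r \<Longrightarrow> v \<in> V"
  shows "descending_chains r (U \<union> V) x n = descending_chains r U x n \<union> descending_chains r V x n"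
proof
  show "descending_chains r (U \<union> V) x n \<subseteq> descending_chains r U x n \<union> descending_chains r V x n"
  proof
    fix ys assume ys: "ys \<in> descending_chains r (U \<union> V) x n"
    then have "last ys \<in> U \<union> V"
      by (auto simp: descending_chains_def dest: last_in_set)
    moreover have "set ys \<subseteq> W" if "last ys \<in> W" "\<And>u v. u \<in> W \<Longrightarrow> (u, v) \<in> r \<Longrightarrow> v \<in> W" for W
      using descending_chain_last_le[OF ys] that by blast
    ultimately have "set ys \<subseteq> U \<or> set ys \<subseteq> V"
      using assms by blast
    then show "ys \<in> descending_chains r U x n \<union> descending_chains r V x n"
      using ys by (auto simp: descending_chains_def)
  qed
qed (use descending_chains_mono[of U "U \<union> V"] descending_chains_mono[of V "U \<union> V"] in auto)

lemma delete_mem_descending_chains: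
  assumes "ys \<in> descending_chains r U x (Suc n)" "1 \<le> i" "i < length ys"
  shows "take i ys @ drop (Suc i) ys \<in> descending_chains r U x n"
proof -
  have "sorted_wrt (\<lambda>u v. strictly_below r v u) (take i ys @ ys ! i # drop (Suc i) ys)"
    using assms by (simp add: id_take_nth_drop[symmetric] descending_chains_def)
  moreover have "hd (take i ys @ drop (Suc i) ys) = hd ys"
    using assms by (cases ys; cases i) auto
  ultimately show ?thesis
    using assms
    by (auto simp: descending_chains_def sorted_wrt_append dest!: in_set_takeD in_set_dropD)
qed

lemma keys_tail_boundary:
  assumes "Poly_Mapping.keys c \<subseteq> descending_chains r U x (Suc n)"
  shows "Poly_Mapping.keys (tail_boundary c) \<subseteq> descending_chains r U x n"
  unfolding tail_boundary_def
proof (rule keys_additive_ext_subset[OF assms])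
  fix ys :: "'a list" and k :: 'b
  assume "ys \<in> descending_chains r U x (Suc n)"
  then show "Poly_Mapping.keys (\<Sum>i\<in>{1..<length ys}.
      Poly_Mapping.single (take i ys @ drop (Suc i) ys) ((- 1) ^ i * k)) \<subseteq> descending_chains r U x n"
    by (intro order.trans[OF keys_sum]) (auto intro: delete_mem_descending_chains)
qed

text \<open>All entries lie above \<open>a\<close>, so the complex is a cone and
  \<open>cone_op a\<close> contracts it up to sign. The assumption \<open>a \<noteq> x\<close> makes
  the apex a genuine vertex instead of the protected head; for \<open>n = 1\<close>, the list
  \<open>[x]\<close> is up to sign the boundary of \<open>[x, a]\<close>.\<close>

lemma chains_exact_cone:
  fixes K :: "'k::comm_ring_1 itself" and r :: "'b rel"
  assumes "Partial_order r" "x \<in> Field r" "(a, x) \<in> r" "a \<noteq> x" "0 < n"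
  shows "chains_exact K r {z. (a, z) \<in> r} x n"
  unfolding chains_exact_def
proof (intro allI impI, elim conjE)
  let ?V = "{z. (a, z) \<in> r}"
  fix c :: "'b list \<Rightarrow>\<^sub>0 'k"
  assume keys: "Poly_Mapping.keys c \<subseteq> descending_chains r ?V x n" and "tail_boundary c = 0"
  \<comment> \<open>The apex is minimal, so it can only be the last entry, as the homotopy identity
    requires.\<close>
  have a: "a \<notin> set (butlast ys) \<and> last ys = a \<and> 1 < n"
    if ys: "ys \<in> descending_chains r ?V x n" and "a \<in> set ys" for ys
  proof -
    have "last ys \<in> ?V" "ys \<noteq> []" "hd ys = x"
      using ys by (auto simp: descending_chains_def dest: last_in_set)
    then have "last ys = a"
      using descending_chain_last_le[OF ys \<open>a \<in> set ys\<close>] Partial_orderD(3)[OF assms(1)] by blast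
    moreover have "ys = butlast ys @ [last ys]"
      using \<open>ys \<noteq> []\<close> by simp
    then have "sorted_wrt (\<lambda>u v. strictly_below r v u) (butlast ys @ [last ys])"
      using ys by (simp add: descending_chains_def)
    then have "last ys \<notin> set (butlast ys)"
      by (auto simp: sorted_wrt_append strictly_below_def)
    moreover have "1 < length ys"
      using \<open>ys \<noteq> []\<close> \<open>hd ys = x\<close> \<open>last ys = a\<close> assms(4) by (cases ys; cases "tl ys") auto
    ultimately show ?thesis
      using ys by (auto simp: descending_chains_def)
  qed
  have "Poly_Mapping.keys c \<subseteq>
      {xs. length xs = n \<and> (a \<in> set xs \<longrightarrow> a \<notin> set (butlast xs) \<and> last xs = a \<and> 1 < n)}"
  proof
    fix ys assume "ys \<in> Poly_Mapping.keys c"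
    then have ys: "ys \<in> descending_chains r ?V x n"
      using keys by blast
    then have "length ys = n"
      by (simp add: descending_chains_def)
    then show "ys \<in> {xs. length xs = n \<and> (a \<in> set xs \<longrightarrow> a \<notin> set (butlast xs) \<and> last xs = a \<and> 1 < n)}"
      using a[OF ys] by blast
  qed
  from tail_boundary_cone_op[OF this \<open>0 < n\<close>]
  have "tail_boundary (cone_op a c) = alternate n c"
    using \<open>tail_boundary c = 0\<close> by (simp add: additive.zero[OF additive_cone_op])
  then have "tail_boundary (alternate n (cone_op a c)) = c"
    by (simp add: alternate_commute[OF additive_tail_boundary])
  moreover have "Poly_Mapping.keys (cone_op a c) \<subseteq> descending_chains r ?V x (Suc n)"
    unfolding cone_op_def
  proof (rule keys_additive_ext_subset[OF keys])
    fix ys :: "'b list" and k :: 'k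
    assume ys: "ys \<in> descending_chains r ?V x n"
    have "(a, a) \<in> r"
      using Partial_orderD(1)[OF assms(1)] assms(3) by (simp add: FieldI1)
    then have "ys @ [a] \<in> descending_chains r ?V x (Suc n)" if "a \<notin> set ys"
      using ys that by (auto simp: descending_chains_def sorted_wrt_append strictly_below_def)
    then show "Poly_Mapping.keys (if a \<in> set ys then 0 else Poly_Mapping.single (ys @ [a]) k)
        \<subseteq> descending_chains r ?V x (Suc n)"
      by auto
  qed
  ultimately show "\<exists>e. Poly_Mapping.keys e \<subseteq> descending_chains r ?V x (Suc n) \<and> tail_boundary e = c"
    by (intro exI[of _ "alternate n (cone_op a c)"]) simp
qed

lemma poly_mapping_split_keys:
  fixes c :: "'b \<Rightarrow>\<^sub>0 'k::ab_group_add"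
  assumes "Poly_Mapping.keys c \<subseteq> A \<union> B"
  obtains u v where "c = u + v" "Poly_Mapping.keys u \<subseteq> A" "Poly_Mapping.keys v \<subseteq> B"
proof -
  let ?s = "\<lambda>x. Poly_Mapping.single x (Poly_Mapping.lookup c x)"
  let ?u = "\<Sum>x\<in>Poly_Mapping.keys c \<inter> A. ?s x" and ?v = "\<Sum>x\<in>Poly_Mapping.keys c - A. ?s x"
  have "c = ?u + ?v"
    using poly_mapping_sum_single[of c]
      sum.Int_Diff[OF finite_keys, of ?s c A] by simp
  moreover have "Poly_Mapping.keys ?u \<subseteq> A" "Poly_Mapping.keys ?v \<subseteq> B"
    by (rule order.trans[OF keys_sum]; use assms in auto)+
  ultimately show ?thesis
    by (rule that)
qed

text \<open>Mayer--Vietoris: a descending chain lies in an upset as soon as its last element does.\<close>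

lemma chains_exact_Un:
  fixes K :: "'k::comm_ring_1 itself" and r :: "'b rel"
  assumes U: "\<And>u v. u \<in> U \<Longrightarrow> (u, v) \<in> r \<Longrightarrow> v \<in> U" and V: "\<And>u v. u \<in> V \<Longrightarrow> (u, v) \<in> r \<Longrightarrow> v \<in> V"
    and "chains_exact K r U x n" "chains_exact K r V x n"
    and "1 < n \<Longrightarrow> chains_exact K r (U \<inter> V) x (n - 1)" and "0 < n"
  shows "chains_exact K r (U \<union> V) x n"
  unfolding chains_exact_def
proof (intro allI impI, elim conjE)
  note add = additive.add[OF additive_tail_boundary] and diff = additive.diff[OF additive_tail_boundary]
  fix c :: "'b list \<Rightarrow>\<^sub>0 'k"
  assume keys: "Poly_Mapping.keys c \<subseteq> descending_chains r (U \<union> V) x n" and c: "tail_boundary c = 0"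
  have "descending_chains r (U \<union> V) x n = descending_chains r U x n \<union> descending_chains r V x n"
    using U V by (rule descending_chains_Un)
  with keys have "Poly_Mapping.keys c \<subseteq> descending_chains r U x n \<union> descending_chains r V x n"
    by simp
  then obtain u v where uv: "c = u + v" and u: "Poly_Mapping.keys u \<subseteq> descending_chains r U x n"
    and v: "Poly_Mapping.keys v \<subseteq> descending_chains r V x n"
    by (rule poly_mapping_split_keys)
  \<comment> \<open>The boundaries of \<open>u\<close> and \<open>v\<close> cancel, so that of
    \<open>u\<close> is a cycle supported on both pieces. A filling \<open>w\<close> in the
    intersection turns \<open>u - w\<close> and \<open>v + w\<close> into cycles. For
    \<open>n = 1\<close> only \<open>[x]\<close> occurs, its boundary is 0 and \<open>w = 0\<close>
    works, so nothing is asked of the intersection there.\<close>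
  obtain w where w: "Poly_Mapping.keys w \<subseteq> descending_chains r (U \<inter> V) x n"
    "tail_boundary w = tail_boundary u"
  proof (cases "n = 1")
    case True
    have "tail_boundary u = 0"
      by (rule additive_eq_on_keys[OF _ _ u, of _ "\<lambda>_. 0"])
        (use True in \<open>auto intro!: additive_intros simp: descending_chains_def length_Suc_conv\<close>)
    then show ?thesis
      using that[of 0] by (simp add: additive.zero[OF additive_tail_boundary])
  next
    case False
    then have n: "n = Suc (n - 1)" "1 < n"
      using \<open>0 < n\<close> by auto
    have "tail_boundary u = - tail_boundary v"
      using c by (simp add: uv add eq_neg_iff_add_eq_0)
    then have "Poly_Mapping.keys (tail_boundary u) \<subseteq> descending_chains r V x (n - 1)"
      using keys_tail_boundary[of v r V x "n - 1"] v n by simp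
    then have "Poly_Mapping.keys (tail_boundary u) \<subseteq> descending_chains r (U \<inter> V) x (n - 1)"
      using keys_tail_boundary[of u r U x "n - 1"] u n by (auto simp flip: descending_chains_Int)
    then show ?thesis
      using assms(5) n that tail_boundary_tail_boundary[of u] unfolding chains_exact_def by fastforce
  qed
  have wU: "Poly_Mapping.keys w \<subseteq> descending_chains r U x n"
    and wV: "Poly_Mapping.keys w \<subseteq> descending_chains r V x n"
    using w(1) by (auto simp flip: descending_chains_Int)
  have "Poly_Mapping.keys (u - w) \<subseteq> descending_chains r U x n"
    using keys_diff[of u w] u wU by blast
  moreover have "tail_boundary (u - w) = 0"
    using w(2) by (simp add: diff)
  ultimately obtain p where p: "Poly_Mapping.keys p \<subseteq> descending_chains r U x (Suc n)"
      "tail_boundary p = u - w"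
    using assms(3) unfolding chains_exact_def by blast
  have "Poly_Mapping.keys (v + w) \<subseteq> descending_chains r V x n"
    using Poly_Mapping.keys_add[of v w] v wV by blast
  moreover have "tail_boundary (v + w) = 0"
    using w(2) c by (simp add: add uv add.commute)
  ultimately obtain q where q: "Poly_Mapping.keys q \<subseteq> descending_chains r V x (Suc n)"
      "tail_boundary q = v + w"
    using assms(4) unfolding chains_exact_def by blast
  have "Poly_Mapping.keys (p + q) \<subseteq> descending_chains r (U \<union> V) x (Suc n)"
    using Poly_Mapping.keys_add[of p q] p(1) q(1)
      descending_chains_mono[of U "U \<union> V" r x "Suc n"] descending_chains_mono[of V "U \<union> V" r x "Suc n"]
    by blast
  moreover have "tail_boundary (p + q) = c"
    by (simp add: add p q uv)
  ultimately show "\<exists>e. Poly_Mapping.keys e \<subseteq> descending_chains r (U \<union> V) x (Suc n) \<and> tail_boundary e = c"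
    by blast
qed

lemma chains_exact_cong:
  assumes "\<And>n. descending_chains r U x n = descending_chains s V x n"
  shows "chains_exact K r U x n = chains_exact K s V x n"
  by (simp add: chains_exact_def assms)

text \<open>The outer induction follows the recursive structure, the inner one adds atoms one at a
  time. The claim covers all initial segments because the intersection with the new cone is
  generated by an initial segment of the ordering of \<open>[a, t]\<close>. The bound puts
  \<open>n\<close> below the rank of \<open>[b, x]\<close>; passing to that intersection lowers
  \<open>n\<close> by one and raises the rank of the bottom by one, which preserves it.\<close>

lemma recursive_atom_ordering_chains_exact:
  fixes K :: "'k::comm_ring_1 itself" and r :: "'b rel"
  assumes "recursive_atom_ordering r as" "\<And>x y. covered_by r x y \<Longrightarrow> \<rho> y = Suc (\<rho> x)"
    and "least_elem r b" "\<exists>a\<in>set (take m as). (a, x) \<in> r" "0 < n" "n + \<rho> b < \<rho> x"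
  shows "chains_exact K r {z. \<exists>a\<in>set (take m as). (a, z) \<in> r} x n"
  using assms
proof (induction arbitrary: b m x n rule: recursive_atom_ordering.induct)
  \<comment> \<open>Here \<open>x = t\<close> has rank one above the bottom, so no positive
    \<open>n\<close> is in range.\<close>
  case (two_elements r b' t)
  have "b = b'"
    using least_elem_unique two_elements by metis
  have "x = t"
  proof -
    have "(t, x) \<in> r"
      using two_elements by (cases m) auto
    moreover from this have "(x, t) \<in> r"
      using \<open>greatest_elem r t\<close> unfolding greatest_elem_def by (blast intro: FieldI2)
    ultimately show ?thesis
      using two_elements Partial_orderD(3) by metis
  qed
  moreover have "set [t] = {a. covered_by r b a}"
    using set_recursive_atom_ordering[OF recursive_atom_ordering.two_elements] two_elements by metis
  then have "covered_by r b t"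
    by (metis list.set_intros(1) mem_Collect_eq)
  then have "\<rho> t = Suc (\<rho> b)"
    using two_elements by blast
  ultimately have "n + \<rho> b < Suc (\<rho> b)"
    using two_elements by simp
  then show ?case
    using \<open>0 < n\<close> by simp
next
  case (at_least_three_elements r b' t as)
  note order = Partial_orderD[OF \<open>Partial_order r\<close>]
  have "b' = b"
    using least_elem_unique at_least_three_elements by metis
  note rank = at_least_three_elements(10)
  note step = at_least_three_elements.IH and cond2 = at_least_three_elements(8)
  have atoms: "set as = {a. covered_by r b a}"
    using at_least_three_elements(7) \<open>b' = b\<close> by simp
  have x: "x \<in> Field r"
    using at_least_three_elements(12) by (auto simp: FieldI2)
  have up: "v \<in> {z. \<exists>a\<in>A. (a, z) \<in> r}" if "u \<in> {z. \<exists>a\<in>A. (a, z) \<in> r}" "(u, v) \<in> r" for u v A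
    using that order(2) by blast
  have below_top: "(z, t) \<in> r" if "z \<in> Field r" for z
    using \<open>greatest_elem r t\<close> that by (simp add: greatest_elem_def)
  \<comment> \<open>The condition on \<open>x\<close> enters the claim, because \<open>x\<close> may
    lie above the new atom without lying above any earlier one.\<close>
  have "(\<exists>a\<in>set (take m as). (a, x) \<in> r) \<longrightarrow> chains_exact K r {z. \<exists>a\<in>set (take m as). (a, z) \<in> r} x n"
  proof (induction m)
    case (Suc m)
    show ?case
    proof (cases "m < length as")
      case True
      define a where "a = as ! m"
      define U where "U = {z. \<exists>a\<in>set (take m as). (a, z) \<in> r}"
      define V where "V = {z. (a, z) \<in> r}"
      have UV: "{z. \<exists>a\<in>set (take (Suc m) as). (a, z) \<in> r} = U \<union> V"
        using True by (auto simp: U_def V_def a_def take_Suc_conv_app_nth)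
      have a: "covered_by r b a"
        using atoms True unfolding a_def by (metis mem_Collect_eq nth_mem)
      then have "\<rho> a = Suc (\<rho> b)"
        by (rule rank)
      then have "x \<noteq> a"
        using at_least_three_elements(13,14) by auto
      have upU: "v \<in> U" if "u \<in> U" "(u, v) \<in> r" for u v
        using that up[of u "set (take m as)" v] by (simp add: U_def)
      have upV: "v \<in> V" if "u \<in> V" "(u, v) \<in> r" for u v
        using that order(2) by (simp add: V_def)
      have exact_V: "chains_exact K r V x n" if "x \<in> V"
        unfolding V_def
        by (rule chains_exact_cone) (use that x \<open>x \<noteq> a\<close> at_least_three_elements in \<open>auto simp: V_def\<close>)
      have exact_U: "chains_exact K r U x n" if "x \<in> U"
        using Suc.IH that by (simp add: U_def)
      show ?thesis
        unfolding UV
      proof (intro impI)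
        assume "\<exists>a\<in>set (take (Suc m) as). (a, x) \<in> r"
        then have "x \<in> U \<union> V"
          using UV by blast
        then consider "x \<in> U" "x \<notin> V" | "x \<notin> U" "x \<in> V" | "x \<in> U" "x \<in> V"
          by blast
        then show "chains_exact K r (U \<union> V) x n"
        proof cases
          case 1
          \<comment> \<open>\<open>V\<close> is upward closed and misses \<open>x\<close>, so
            nothing below \<open>x\<close> lies in \<open>V\<close>. The next case is
            symmetric.\<close>
          then have "descending_chains r (U \<union> V) x k = descending_chains r U x k" for k
            by (intro descending_chains_cong) (use upV x \<open>Partial_order r\<close> in blast)+
          then show ?thesis
            using chains_exact_cong exact_U 1 by metis
        next
          case 2
          then have "descending_chains r (U \<union> V) x k = descending_chains r V x k" for k
            by (intro descending_chains_cong) (use upU x \<open>Partial_order r\<close> in blast)+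
          then show ?thesis
            using chains_exact_cong exact_V 2 by metis
        next
          case 3
          let ?s = "closed_interval r a t"
          obtain bs l where
            IH: "(\<forall>x y. covered_by ?s x y \<longrightarrow> \<rho> y = Suc (\<rho> x)) \<longrightarrow>
              (\<forall>c. least_elem ?s c \<longrightarrow> (\<forall>m x. (\<exists>a\<in>set (take m bs). (a, x) \<in> ?s) \<longrightarrow>
                (\<forall>n>0. n + \<rho> c < \<rho> x \<longrightarrow>
                  chains_exact K ?s {z. \<exists>a\<in>set (take m bs). (a, z) \<in> ?s} x n)))"
            and bs: "recursive_atom_ordering ?s bs"
            and l: "set (take l bs) = {c \<in> set bs. \<exists>i<m. covered_by r (as ! i) c}"
            using step[rule_format, OF True, folded a_def] by (elim exE conjE) (rule that)
          have at: "(a, t) \<in> r"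
            using below_top a by (auto simp: FieldI2 dest!: covered_byD)
          note least = least_elem_closed_interval[OF \<open>Partial_order r\<close> at]
          have set_bs: "c \<in> set bs \<longleftrightarrow> covered_by r a c" for c
            using set_recursive_atom_ordering[OF bs least(1)] below_top order(1) at
            by (auto simp: covered_by_closed_interval[OF \<open>Partial_order r\<close>] FieldI1 FieldI2 dest: covered_byD)
          \<comment> \<open>Condition (2) puts a common cover of \<open>a\<close> and an earlier
            atom below every common upper bound \<open>z\<close>. By condition (1), these covers are
            exactly the first \<open>l\<close> atoms of \<open>[a, t]\<close>, so they generate
            \<open>U \<inter> V\<close>.\<close>
          have join: "\<exists>c\<in>set (take l bs). (c, z) \<in> r" if z: "z \<in> U" "z \<in> V" for z
          proof -
            obtain i where i: "i < m" "(as ! i, z) \<in> r"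
              using z True by (auto simp: U_def in_set_conv_nth)
            have ai: "covered_by r b (as ! i)"
              using atoms i True by (metis mem_Collect_eq nth_mem order.strict_trans)
            have "as ! i \<noteq> a"
              using \<open>distinct as\<close> i True by (simp add: a_def nth_eq_iff_index_eq)
            then have "strictly_below r (as ! i) z" "strictly_below r a z"
              using i z ai a unfolding strictly_below_def covered_by_unfold V_def by blast+
            then obtain l' c where "l' < m" "covered_by r (as ! l') c" "covered_by r a c" "(c, z) \<in> r"
              using cond2 True i unfolding a_def by blast
            then show ?thesis
              using l set_bs by auto
          qed
          have W: "{z. \<exists>c\<in>set (take l bs). (c, z) \<in> ?s} = U \<inter> V"
          proof (intro equalityI subsetI)
            fix z assume "z \<in> {z. \<exists>c\<in>set (take l bs). (c, z) \<in> ?s}"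
            then obtain c i where "(c, z) \<in> ?s" "i < m" "covered_by r (as ! i) c"
              unfolding l by blast
            then have "(as ! i, z) \<in> r" "(a, z) \<in> r"
              using order(2) by (auto simp: closed_interval_iff dest: covered_byD)
            moreover have "as ! i \<in> set (take m as)"
              using \<open>i < m\<close> True by (auto simp: in_set_conv_nth)
            ultimately show "z \<in> U \<inter> V"
              by (auto simp: U_def V_def)
          next
            fix z assume z: "z \<in> U \<inter> V"
            then obtain c where c: "c \<in> set (take l bs)" "(c, z) \<in> r"
              using join by blast
            then have "(a, c) \<in> r"
              using set_bs by (meson covered_byD in_set_takeD)
            then have "(c, z) \<in> ?s"
              using c z order(2) below_top by (auto simp: closed_interval_iff V_def FieldI2 FieldI1)
            then show "z \<in> {z. \<exists>c\<in>set (take l bs). (c, z) \<in> ?s}"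
              using c by blast
          qed
          have "chains_exact K r (U \<inter> V) x (n - 1)" if "1 < n"
          proof -
            have "descending_chains r (U \<inter> V) x k = descending_chains ?s (U \<inter> V) x k" for k
              by (rule descending_chains_closed_interval[symmetric])
                (use below_top in \<open>auto simp: V_def FieldI2\<close>)
            moreover have "chains_exact K ?s (U \<inter> V) x (n - 1)"
              unfolding W[symmetric]
            proof (rule IH[rule_format, OF _ least(1)])
              show "\<rho> z = Suc (\<rho> y)" if "covered_by ?s y z" for y z
                using that by (intro rank) (simp add: covered_by_closed_interval[OF \<open>Partial_order r\<close>])
              show "\<exists>c\<in>set (take l bs). (c, x) \<in> ?s"
                using W 3 by blast
              show "n - 1 + \<rho> a < \<rho> x"
                using at_least_three_elements(14) \<open>\<rho> a = Suc (\<rho> b)\<close> that by simp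
            qed (use that in simp)
            ultimately show ?thesis
              using chains_exact_cong by metis
          qed
          then show ?thesis
            using chains_exact_Un[of U r V] upU upV exact_U exact_V 3 \<open>0 < n\<close> by blast
        qed
      qed
    qed (use Suc in simp)
  qed simp
  then show ?case
    using at_least_three_elements(12) by blast
qed

section \<open>Cohen--Macaulayness from a recursive atom ordering\<close>

lemma covered_by_exists:
  assumes "finite (Field r)" "Partial_order r" "(x, y) \<in> r" "x \<noteq> y"
  obtains a where "covered_by r x a" "(a, y) \<in> r"
proof -
  note order = Partial_orderD[OF assms(2)]
  have "\<exists>a. covered_by r x a \<and> (a, y) \<in> r"
    using assms(3,4)
  proof (induction "card {z. (x, z) \<in> r \<and> (z, y) \<in> r}" arbitrary: y rule: less_induct)
    case less
    show ?case
    proof (cases "covered_by r x y")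
      case True
      then show ?thesis
        using less.prems order(1) by (meson FieldI2)
    next
      case False
      then obtain z where z: "(x, z) \<in> r" "(z, y) \<in> r" "z \<noteq> x" "z \<noteq> y"
        using less.prems by (auto simp: covered_by_unfold)
      have "{w. (x, w) \<in> r \<and> (w, z) \<in> r} \<subset> {w. (x, w) \<in> r \<and> (w, y) \<in> r}"
      proof
        show "{w. (x, w) \<in> r \<and> (w, z) \<in> r} \<subseteq> {w. (x, w) \<in> r \<and> (w, y) \<in> r}"
          using order(2) z by blast
        have "y \<in> {w. (x, w) \<in> r \<and> (w, y) \<in> r} - {w. (x, w) \<in> r \<and> (w, z) \<in> r}"
          using order(1)[OF FieldI2[OF less.prems(1)]] order(3) less.prems z by blast
        then show "{w. (x, w) \<in> r \<and> (w, z) \<in> r} \<noteq> {w. (x, w) \<in> r \<and> (w, y) \<in> r}"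
          by blast
      qed
      moreover have "finite {w. (x, w) \<in> r \<and> (w, y) \<in> r}"
        by (rule finite_subset[OF _ assms(1)]) (auto simp: FieldI1)
      ultimately have "card {w. (x, w) \<in> r \<and> (w, z) \<in> r} < card {w. (x, w) \<in> r \<and> (w, y) \<in> r}"
        by (simp add: psubset_card_mono)
      then have "\<exists>a. covered_by r x a \<and> (a, z) \<in> r"
        by (rule less.hyps) (use z in auto)
      then show ?thesis
        using order(2) z by blast
    qed
  qed
  then show ?thesis
    using that by blast
qed

lemma rank_strict_mono:
  fixes \<rho> :: "'b \<Rightarrow> nat"
  assumes "finite (Field r)" "Partial_order r" "\<And>x y. covered_by r x y \<Longrightarrow> \<rho> y = Suc (\<rho> x)"
    and "(x, y) \<in> r" "x \<noteq> y"
  shows "\<rho> x < \<rho> y"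
  using assms(4,5)
proof (induction "card {z. (x, z) \<in> r \<and> (z, y) \<in> r}" arbitrary: x rule: less_induct)
  case less
  note order = Partial_orderD[OF assms(2)]
  obtain a where a: "covered_by r x a" "(a, y) \<in> r"
    using covered_by_exists[OF assms(1,2) less.prems] by blast
  show ?case
  proof (cases "a = y")
    case False
    have xa: "(x, a) \<in> r" "x \<noteq> a"
      using a covered_byD by metis+
    have "{w. (a, w) \<in> r \<and> (w, y) \<in> r} \<subset> {w. (x, w) \<in> r \<and> (w, y) \<in> r}"
    proof
      show "{w. (a, w) \<in> r \<and> (w, y) \<in> r} \<subseteq> {w. (x, w) \<in> r \<and> (w, y) \<in> r}"
        using order(2) xa by blast
      have "x \<in> {w. (x, w) \<in> r \<and> (w, y) \<in> r} - {w. (a, w) \<in> r \<and> (w, y) \<in> r}"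
        using order(1)[OF FieldI1[OF less.prems(1)]] order(3) less.prems xa by blast
      then show "{w. (a, w) \<in> r \<and> (w, y) \<in> r} \<noteq> {w. (x, w) \<in> r \<and> (w, y) \<in> r}"
        by blast
    qed
    moreover have "finite {w. (x, w) \<in> r \<and> (w, y) \<in> r}"
      by (rule finite_subset[OF _ assms(1)]) (auto simp: FieldI1)
    ultimately have "card {w. (a, w) \<in> r \<and> (w, y) \<in> r} < card {w. (x, w) \<in> r \<and> (w, y) \<in> r}"
      by (simp add: psubset_card_mono)
    then have "\<rho> a < \<rho> y"
      by (rule less.hyps) (use a False in auto)
    then show ?thesis
      using assms(3)[OF a(1)] by simp
  qed (use assms(3) a in simp)
qed

text \<open>The rank maps a maximal chain bijectively onto \<open>{\<rho> x..\<rho> y}\<close>. If a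
  value \<open>k\<close> were skipped, the chain elements \<open>u\<close> and \<open>v\<close> next
  to the gap would differ in rank by at least two; so \<open>v\<close> does not cover
  \<open>u\<close>, and an element strictly between them would extend the chain.\<close>

lemma card_maximal_chain_closed_interval:
  fixes \<rho> :: "'b \<Rightarrow> nat"
  assumes "finite (Field r)" "Partial_order r" "\<And>x y. covered_by r x y \<Longrightarrow> \<rho> y = Suc (\<rho> x)"
    and "(x, y) \<in> r" and C: "C \<in> maximal_chains (closed_interval r x y)"
  shows "finite C" "card C = Suc (\<rho> y - \<rho> x)"
proof -
  note order = Partial_orderD[OF assms(2)]
  have strict: "\<rho> u < \<rho> v" if "(u, v) \<in> r" "u \<noteq> v" for u v
    using rank_strict_mono[OF assms(1,2) _ that] assms(3) by blast
  let ?s = "closed_interval r x y"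
  have chain: "C \<in> Chains ?s" and max: "\<And>D. D \<in> Chains ?s \<Longrightarrow> C \<subseteq> D \<Longrightarrow> D = C"
    using C by (auto simp: maximal_chains_def)
  have comparable: "(u, v) \<in> r \<or> (v, u) \<in> r" if "u \<in> C" "v \<in> C" for u v
    using chain that by (auto simp: Chains_def closed_interval_iff)
  have between: "(x, u) \<in> r \<and> (u, y) \<in> r" if "u \<in> C" for u
    using chain that by (auto simp: Chains_def closed_interval_iff)
  show fin: "finite C"
    by (rule finite_subset[OF _ assms(1)]) (use between in \<open>blast intro: FieldI2\<close>)
  have mem: "z \<in> C" if z: "(x, z) \<in> r" "(z, y) \<in> r" "\<And>w. w \<in> C \<Longrightarrow> (w, z) \<in> r \<or> (z, w) \<in> r" for z
  proof -
    have "(z, z) \<in> r"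
      using order(1) z(1) by (simp add: FieldI2)
    then have "insert z C \<in> Chains ?s"
      using chain between z by (auto simp: Chains_def closed_interval_iff)
    then show ?thesis
      using max by blast
  qed
  have "x \<in> C" "y \<in> C"
    using mem between assms(4) order(1) by (meson FieldI1 FieldI2)+
  have mono: "(u, v) \<in> r" if "u \<in> C" "v \<in> C" "\<rho> u \<le> \<rho> v" for u v
    using comparable[OF that(1,2)] strict[of v u] that(3) by force
  have "\<rho> ` C = {\<rho> x..\<rho> y}"
  proof (intro equalityI subsetI)
    fix k assume "k \<in> \<rho> ` C"
    then show "k \<in> {\<rho> x..\<rho> y}"
      using between strict by (force simp: le_less)
  next
    fix k assume k: "k \<in> {\<rho> x..\<rho> y}"
    show "k \<in> \<rho> ` C"
    proof (rule ccontr)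
      assume notin: "k \<notin> \<rho> ` C"
      let ?A = "{w \<in> C. \<rho> w < k}" and ?B = "{w \<in> C. k < \<rho> w}"
      have "x \<in> ?A" "y \<in> ?B"
        using \<open>x \<in> C\<close> \<open>y \<in> C\<close> k notin by (auto simp: order.order_iff_strict)
      then have "Max (\<rho> ` ?A) \<in> \<rho> ` ?A" "Min (\<rho> ` ?B) \<in> \<rho> ` ?B"
        using fin by (intro Max_in Min_in; auto)+
      then obtain u v where uv: "u \<in> ?A" "\<rho> u = Max (\<rho> ` ?A)" "v \<in> ?B" "\<rho> v = Min (\<rho> ` ?B)"
        by auto
      have u: "\<rho> w \<le> \<rho> u" if "w \<in> C" "\<rho> w < k" for w
        using uv(2) fin that by simp
      have v: "\<rho> v \<le> \<rho> w" if "w \<in> C" "k < \<rho> w" for w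
        using uv(4) fin that by simp
      have "(u, v) \<in> r" "u \<noteq> v"
        using mono uv by auto
      moreover have "\<not> covered_by r u v"
        using assms(3) uv by fastforce
      ultimately obtain z where z: "(u, z) \<in> r" "(z, v) \<in> r" "z \<noteq> u" "z \<noteq> v"
        by (auto simp: covered_by_unfold)
      have "z \<in> C"
      proof (rule mem)
        show "(x, z) \<in> r" "(z, y) \<in> r"
          using order(2) between uv z by blast+
        fix w assume "w \<in> C"
        then have "\<rho> w \<noteq> k"
          using notin by blast
        then consider "\<rho> w < k" | "k < \<rho> w"
          by linarith
        then show "(w, z) \<in> r \<or> (z, w) \<in> r"
        proof cases
          case 1
          then have "(w, u) \<in> r"
            using mono u \<open>w \<in> C\<close> uv by blast
          then show ?thesis
            using order(2) z by blast
        next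
          case 2
          then have "(v, w) \<in> r"
            using mono v \<open>w \<in> C\<close> uv by blast
          then show ?thesis
            using order(2) z by blast
        qed
      qed
      moreover have "\<rho> u < \<rho> z" "\<rho> z < \<rho> v"
        using strict z by auto
      ultimately show False
        using u[of z] v[of z] notin by (cases "\<rho> z" k rule: linorder_cases) auto
    qed
  qed
  moreover have "inj_on \<rho> C"
    using comparable strict by (metis inj_onI less_irrefl)
  ultimately have "card C = card {\<rho> x..\<rho> y}"
    using card_image by metis
  moreover have "\<rho> x \<le> \<rho> y"
    using strict[OF assms(4)] by (cases "x = y") auto
  ultimately show "card C = Suc (\<rho> y - \<rho> x)"
    by simp
qed

lemma maximal_chain_exists:
  assumes "finite (Field r)"
  shows "maximal_chains r \<noteq> {}"
proof -
  have "Chains r \<subseteq> Pow (Field r)"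
    unfolding Chains_def by (blast intro: FieldI1)
  then have "finite (Chains r)"
    using assms by (simp add: finite_subset)
  moreover have "{} \<in> Chains r"
    by (simp add: Chains_def)
  ultimately show ?thesis
    using finite_has_maximal[of "Chains r"] unfolding maximal_chains_def by blast
qed

text \<open>\<open>has_rank\<close> quantifies over the maximal chains and would hold for all
  \<open>n\<close> if there were none. Finiteness provides one, which makes the rank unique.\<close>

lemma has_rank_closed_interval:
  fixes \<rho> :: "'b \<Rightarrow> nat"
  assumes "finite (Field r)" "Partial_order r" "\<And>x y. covered_by r x y \<Longrightarrow> \<rho> y = Suc (\<rho> x)"
    and "(x, y) \<in> r"
  shows "has_rank (closed_interval r x y) n \<longleftrightarrow> n = \<rho> y - \<rho> x"
proof -
  have "finite (Field (closed_interval r x y))"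
    by (rule finite_subset[OF _ assms(1)]) (auto simp: Field_def closed_interval_iff)
  then obtain C where "C \<in> maximal_chains (closed_interval r x y)"
    using maximal_chain_exists by blast
  then show ?thesis
    using card_maximal_chain_closed_interval[OF assms(1,2) _ assms(4), of \<rho>] assms(3)
    unfolding has_rank_def by (metis Suc_inject)
qed

lemma closed_interval_converse: "closed_interval (r\<inverse>) x y = (closed_interval r y x)\<inverse>"
  by (auto simp: closed_interval_iff)

lemma has_rank_converse: "has_rank (r\<inverse>) n \<longleftrightarrow> has_rank r n"
proof -
  have "Chains (r\<inverse>) = Chains r"
    by (auto simp: Chains_def)
  then show ?thesis
    by (simp add: has_rank_def maximal_chains_def)
qed

text \<open>An element other than the bottom lies above some atom \<open>a\<close>, and
  \<open>[y, t]\<close> is an upper interval of \<open>[a, t]\<close>, where the recursion applies.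
  The case \<open>y = t\<close> would give a one-element poset, which has no recursive atom
  ordering.\<close>

lemma recursive_atom_ordering_closed_interval:
  assumes "recursive_atom_ordering r as" "finite (Field r)" "greatest_elem r t" "y \<in> Field r" "y \<noteq> t"
  shows "\<exists>bs. recursive_atom_ordering (closed_interval r y t) bs"
  using assms
proof (induction rule: recursive_atom_ordering.induct)
  case (two_elements r b t')
  then have "t' = t"
    by (blast intro: greatest_elem_unique)
  with two_elements have "y = b"
    by blast
  moreover have "recursive_atom_ordering r [t']"
    using two_elements by (intro recursive_atom_ordering.two_elements)
  ultimately show ?case
    using closed_interval_least_greatest[OF \<open>least_elem r b\<close> \<open>greatest_elem r t\<close>] by auto
next
  case (at_least_three_elements r b t' as)
  note order = Partial_orderD[OF \<open>Partial_order r\<close>]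
  have [simp]: "t' = t"
    using at_least_three_elements.hyps(1,3) at_least_three_elements.prems(2)
    by (rule greatest_elem_unique)
  have "(y, t) \<in> r" "(b, y) \<in> r"
    using at_least_three_elements by (auto simp: greatest_elem_def least_elem_def)
  show ?case
  proof (cases "y = b")
    case True
    have "\<forall>j<length as. \<exists>bs. recursive_atom_ordering (closed_interval r (as ! j) t') bs \<and>
        (\<exists>m. set (take m bs) = {c \<in> set bs. \<exists>i<j. covered_by r (as ! i) c})"
      using at_least_three_elements.IH by blast
    with at_least_three_elements.hyps have "recursive_atom_ordering r as"
      by (intro recursive_atom_ordering.at_least_three_elements)
    moreover have "closed_interval r y t = r"
      using closed_interval_least_greatest[OF \<open>least_elem r b\<close> \<open>greatest_elem r t\<close>] True by simp
    ultimately show ?thesis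
      by auto
  next
    case False
    then obtain a where a: "covered_by r b a" "(a, y) \<in> r"
      using covered_by_exists[OF \<open>finite (Field r)\<close> \<open>Partial_order r\<close> \<open>(b, y) \<in> r\<close>] by blast
    then obtain j where j: "j < length as" "as ! j = a"
      using \<open>set as = {a. covered_by r b a}\<close> by (metis in_set_conv_nth mem_Collect_eq)
    let ?s = "closed_interval r a t"
    obtain bs where IH: "finite (Field ?s) \<longrightarrow> greatest_elem ?s t \<longrightarrow> y \<in> Field ?s \<longrightarrow> y \<noteq> t \<longrightarrow>
        (\<exists>bs. recursive_atom_ordering (closed_interval ?s y t) bs)"
      using at_least_three_elements.IH[rule_format, OF j(1)] unfolding j(2) \<open>t' = t\<close> by blast
    have at: "(a, t) \<in> r"
      using order(2) a \<open>(y, t) \<in> r\<close> by blast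
    have "finite (Field ?s)"
      by (rule finite_subset[OF _ \<open>finite (Field r)\<close>]) (auto simp: Field_def closed_interval_iff)
    moreover have "y \<in> Field ?s"
      using a \<open>(y, t) \<in> r\<close> by (simp add: Field_closed_interval[OF \<open>Partial_order r\<close>])
    moreover have "closed_interval ?s y t = closed_interval r y t"
      using closed_interval_closed_interval[OF \<open>Partial_order r\<close>] a \<open>(y, t) \<in> r\<close> by blast
    ultimately show ?thesis
      using IH least_elem_closed_interval(2)[OF \<open>Partial_order r\<close> at] \<open>y \<noteq> t\<close> by auto
  qed
qed

text \<open>The ranks decrease strictly along the list and stay in
  \<open>{\<rho> y<..\<rho> x}\<close>.\<close>

lemma descending_chains_rank_bound:
  fixes \<rho> :: "'b \<Rightarrow> nat"
  assumes "finite (Field r)" "Partial_order r" "\<And>x y. covered_by r x y \<Longrightarrow> \<rho> y = Suc (\<rho> x)"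
    and "x \<in> Field r" "ys \<in> descending_chains r {z. strictly_below r y z} x n"
  shows "n \<le> \<rho> x - \<rho> y"
proof -
  have strict: "\<rho> u < \<rho> v" if "(u, v) \<in> r" "u \<noteq> v" for u v
    using rank_strict_mono[OF assms(1,2) _ that] assms(3) by blast
  have "sorted_wrt (\<lambda>u v. strictly_below r v u) ys" "length ys = n"
    using assms(5) by (auto simp: descending_chains_def)
  then have "sorted_wrt (\<lambda>u v. \<rho> v < \<rho> u) ys"
    using strict by (auto simp: strictly_below_def elim: sorted_wrt_mono_rel[rotated])
  then have "distinct (map \<rho> ys)"
    by (induction ys) auto
  then have "n = card (\<rho> ` set ys)"
    using \<open>length ys = n\<close> distinct_card[of "map \<rho> ys"] by simp
  also have "\<rho> ` set ys \<subseteq> {\<rho> y<..\<rho> x}"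
  proof clarify
    fix z assume "z \<in> set ys"
    then have "strictly_below r y z" "(z, x) \<in> r"
      using assms(5) descending_chain_le[OF assms(2,4,5)] by (auto simp: descending_chains_def)
    then show "\<rho> z \<in> {\<rho> y<..\<rho> x}"
      using strict[of y z] strict[of z x] by (cases "z = x") (auto simp: strictly_below_def)
  qed
  then have "card (\<rho> ` set ys) \<le> \<rho> x - \<rho> y"
    using card_mono[of "{\<rho> y<..\<rho> x}"] by simp
  finally show ?thesis .
qed

text \<open>For \<open>n = 0\<close> and for \<open>n\<close> above the rank there are no lists at
  all. In between, all atoms of \<open>[y, t]\<close> together generate the elements strictly above
  \<open>y\<close>, so the gluing result is used with the full list of atoms.\<close>

lemma chains_exact_below_rank:
  fixes \<rho> :: "'b \<Rightarrow> nat"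
  assumes "finite (Field r)" "recursive_atom_ordering r as"
    and "\<And>x y. covered_by r x y \<Longrightarrow> \<rho> y = Suc (\<rho> x)"
    and "(y, x) \<in> r" "y \<noteq> x" "n \<noteq> \<rho> x - \<rho> y"
  shows "chains_exact K r {z. strictly_below r y z} x n"
proof -
  obtain b t where bt: "Partial_order r" "least_elem r b" "greatest_elem r t"
    using assms(2) recursive_atom_ordering_bounded by metis
  note order = Partial_orderD[OF bt(1)]
  have xt: "(x, t) \<in> r" and yt: "(y, t) \<in> r" and x: "x \<in> Field r"
    using bt assms(4) by (auto simp: greatest_elem_def FieldI1 FieldI2)
  have "y \<noteq> t"
    using xt assms(4,5) order(3) by blast
  consider "n = 0 \<or> \<rho> x - \<rho> y < n" | "0 < n" "n < \<rho> x - \<rho> y"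
    using assms(6) by linarith
  then show ?thesis
  proof cases
    case 1
    then have "descending_chains r {z. strictly_below r y z} x n = {}"
    proof
      assume "n = 0"
      then show ?thesis
        by (auto simp: descending_chains_def)
    next
      assume "\<rho> x - \<rho> y < n"
      then show ?thesis
        using descending_chains_rank_bound[OF assms(1) bt(1) _ x, of \<rho>] assms(3)
        by (metis all_not_in_conv leD)
    qed
    then show ?thesis
      by (auto simp: chains_exact_def intro!: exI[of _ 0] additive.zero[OF additive_tail_boundary])
  next
    case 2
    let ?s = "closed_interval r y t" and ?U = "{z. strictly_below r y z}"
    obtain bs where bs: "recursive_atom_ordering ?s bs"
      using recursive_atom_ordering_closed_interval[OF assms(2,1) bt(3) _ \<open>y \<noteq> t\<close>] assms(4)
      by (auto simp: FieldI1)
    have U: "{z. \<exists>a\<in>set (take (length bs) bs). (a, z) \<in> ?s} = ?U"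
    proof (intro equalityI subsetI)
      fix z assume "z \<in> {z. \<exists>a\<in>set (take (length bs) bs). (a, z) \<in> ?s}"
      then obtain a where a: "covered_by r y a" "(a, z) \<in> r"
        using set_recursive_atom_ordering[OF bs least_elem_closed_interval(1)[OF bt(1) yt]]
        by (auto simp: covered_by_closed_interval[OF bt(1)] closed_interval_iff)
      then show "z \<in> ?U"
        using order(2,3) by (auto simp: strictly_below_def dest!: covered_byD)
    next
      fix z assume z: "z \<in> ?U"
      then obtain a where a: "covered_by r y a" "(a, z) \<in> r"
        using covered_by_exists[OF assms(1) bt(1)] by (auto simp: strictly_below_def)
      have "(a, t) \<in> r" "(z, t) \<in> r" "(y, a) \<in> r" "(y, z) \<in> r" "(y, y) \<in> r"
        using bt(3) a z covered_byD[OF a(1)] order(1) assms(4)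
        by (auto simp: greatest_elem_def strictly_below_def FieldI1 FieldI2)
      then have "a \<in> set bs" "(a, z) \<in> ?s"
        using a set_recursive_atom_ordering[OF bs least_elem_closed_interval(1)[OF bt(1) yt]]
        by (auto simp: covered_by_closed_interval[OF bt(1)] closed_interval_iff)
      then show "z \<in> {z. \<exists>a\<in>set (take (length bs) bs). (a, z) \<in> ?s}"
        by auto
    qed
    have "chains_exact K ?s {z. \<exists>a\<in>set (take (length bs) bs). (a, z) \<in> ?s} x n"
    proof (rule recursive_atom_ordering_chains_exact[OF bs])
      show "\<rho> v = Suc (\<rho> u)" if "covered_by ?s u v" for u v
        using that assms(3) by (simp add: covered_by_closed_interval[OF bt(1)])
      show "least_elem ?s y"
        by (rule least_elem_closed_interval[OF bt(1) yt])
      show "\<exists>a\<in>set (take (length bs) bs). (a, x) \<in> ?s"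
        using U assms(4,5) by (auto simp: strictly_below_def)
      show "0 < n" "n + \<rho> y < \<rho> x"
        using 2 by auto
    qed
    moreover have "descending_chains ?s ?U x k = descending_chains r ?U x k" for k
      by (rule descending_chains_closed_interval)
        (use bt(3) in \<open>auto simp: strictly_below_def greatest_elem_def FieldI2\<close>)
    ultimately show ?thesis
      unfolding U using chains_exact_cong by metis
  qed
qed

section \<open>Transfer to the homology of the dual poset\<close>

lemma strictly_below_converse: "strictly_below (r\<inverse>) = (\<lambda>x y. strictly_below r y x)"
  by (auto simp: fun_eq_iff strictly_below_def)

text \<open>Going up from \<open>x\<close> to \<open>y\<close> in the converse is going down in
  \<open>r\<close>. Since \<open>x \<noteq> y\<close>, something is left after \<open>y\<close> is
  split off.\<close>

lemma strict_chains_converse: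
  assumes "x \<noteq> y" "x \<in> Field r" "y \<in> Field r"
  shows "strict_chains (r\<inverse>) x y n =
    (\<lambda>ys. ys @ [y]) ` descending_chains r {z. strictly_below r y z} x n"
proof (intro equalityI subsetI)
  fix xs assume xs: "xs \<in> strict_chains (r\<inverse>) x y n"
  define ys where "ys = butlast xs"
  have "xs \<noteq> []" "last xs = y"
    using xs by (auto simp: strict_chains_def)
  then have *: "xs = ys @ [y]"
    unfolding ys_def by (metis append_butlast_last_id)
  moreover have "ys \<noteq> []"
    using xs * assms(1) by (auto simp: strict_chains_def)
  ultimately have "ys \<in> descending_chains r {z. strictly_below r y z} x n"
    using xs by (auto simp: strict_chains_def descending_chains_def sorted_wrt_append
        strictly_below_converse)
  then show "xs \<in> (\<lambda>ys. ys @ [y]) ` descending_chains r {z. strictly_below r y z} x n"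
    using * by blast
next
  fix xs assume "xs \<in> (\<lambda>ys. ys @ [y]) ` descending_chains r {z. strictly_below r y z} x n"
  then show "xs \<in> strict_chains (r\<inverse>) x y n"
  proof
    fix ys assume ys: "xs = ys @ [y]" "ys \<in> descending_chains r {z. strictly_below r y z} x n"
    then have "set ys \<subseteq> Field r"
      unfolding descending_chains_def strictly_below_def by (blast intro: FieldI2)
    then show ?thesis
      using ys assms(3)
      by (auto simp: strict_chains_def descending_chains_def sorted_wrt_append strictly_below_converse)
  qed
qed

text \<open>The additive extension of \<open>butlast\<close> is a left inverse.\<close>

lemma inj_append_last: "inj (append_last b)"
proof (rule inj_on_inverseI)
  fix c :: "'a list \<Rightarrow>\<^sub>0 'b"
  let ?strip = "additive_ext (\<lambda>xs. Poly_Mapping.single (butlast xs)) :: ('a list \<Rightarrow>\<^sub>0 'b) \<Rightarrow> _"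
  have strip: "additive ?strip"
    by (rule additive_additive_ext) (rule additive_single)
  show "?strip (append_last b c) = c"
    by (rule additive_eq_on_keys[OF additive_compose[OF strip additive_append_last], where A = UNIV])
      (auto simp: additive_def)
qed

lemma keys_subset_append_last:
  fixes c :: "'b list \<Rightarrow>\<^sub>0 'k::comm_ring_1"
  shows "Poly_Mapping.keys c \<subseteq> (\<lambda>ys. ys @ [b]) ` A \<longleftrightarrow>
    c \<in> append_last b ` {c. Poly_Mapping.keys c \<subseteq> A}"
proof
  assume c: "Poly_Mapping.keys c \<subseteq> (\<lambda>ys. ys @ [b]) ` A"
  let ?strip = "additive_ext (\<lambda>xs. Poly_Mapping.single (butlast xs)) :: ('b list \<Rightarrow>\<^sub>0 'k) \<Rightarrow> _"
  have strip: "additive ?strip"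
    by (rule additive_additive_ext) (rule additive_single)
  have "append_last b (?strip c) = c"
    by (rule additive_eq_on_keys[OF additive_compose[OF additive_append_last strip] _ c])
      (auto simp: additive_def)
  moreover have "Poly_Mapping.keys (?strip c) \<subseteq> A"
    by (rule keys_additive_ext_subset[OF c]) auto
  ultimately show "c \<in> append_last b ` {c. Poly_Mapping.keys c \<subseteq> A}"
    by (metis image_eqI mem_Collect_eq)
next
  assume "c \<in> append_last b ` {c. Poly_Mapping.keys c \<subseteq> A}"
  then obtain d where c: "c = append_last b d" and d: "Poly_Mapping.keys d \<subseteq> A"
    by auto
  show "Poly_Mapping.keys c \<subseteq> (\<lambda>ys. ys @ [b]) ` A"
    unfolding c append_last_def by (rule keys_additive_ext_subset[OF d]) auto
qed

text \<open>\<open>append_last y\<close> identifies the complex of descending lists with that of the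
  interval. As it is injective, being a cycle can be tested before \<open>y\<close> is
  appended.\<close>

lemma chain_cycles_eq_boundaries:
  fixes K :: "'k::comm_ring_1 itself"
  assumes "x \<noteq> y" "x \<in> Field r" "y \<in> Field r"
    and "chains_exact K r {z. strictly_below r y z} x n"
  shows "chain_cycles (r\<inverse>) x y n = (chain_boundaries (r\<inverse>) x y n :: ('b list \<Rightarrow>\<^sub>0 'k) set)"
proof -
  let ?M = "\<lambda>n. {c :: 'b list \<Rightarrow>\<^sub>0 'k. Poly_Mapping.keys c \<subseteq> descending_chains r {z. strictly_below r y z} x n}"
  have chains: "chain_module (r\<inverse>) x y n = append_last y ` ?M n" for n
    unfolding chain_module_def strict_chains_converse[OF assms(1-3)] keys_subset_append_last by simp
  have zero: "append_last y (tail_boundary c) = 0 \<longleftrightarrow> tail_boundary c = 0" for c :: "'b list \<Rightarrow>\<^sub>0 'k"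
    using inj_append_last[of y] additive.zero[OF additive_append_last] by (metis injD)
  have "chain_cycles (r\<inverse>) x y n = append_last y ` {c \<in> ?M n. tail_boundary c = 0}"
    unfolding chain_cycles_def chains by (auto simp: chain_boundary_append_last zero
        additive.zero[OF additive_append_last])
  also have "{c \<in> ?M n. tail_boundary c = 0} = tail_boundary ` ?M (Suc n)"
  proof (intro equalityI subsetI)
    fix c assume "c \<in> {c \<in> ?M n. tail_boundary c = 0}"
    then show "c \<in> tail_boundary ` ?M (Suc n)"
      using assms(4) unfolding chains_exact_def by blast
  next
    fix c assume "c \<in> tail_boundary ` ?M (Suc n)"
    then obtain e where "e \<in> ?M (Suc n)" "c = tail_boundary e"
      by blast
    then show "c \<in> {c \<in> ?M n. tail_boundary c = 0}"
      using keys_tail_boundary[of e r "{z. strictly_below r y z}" x n] by simp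
  qed
  also have "append_last y ` tail_boundary ` ?M (Suc n) = chain_boundaries (r\<inverse>) x y n"
    unfolding chain_boundaries_def chains image_image chain_boundary_append_last ..
  finally show ?thesis .
qed

lemma trivial_group_Mod_carrier:
  assumes "group G"
  shows "trivial_group (G Mod carrier G)"
proof -
  interpret group G by fact
  have "carrier G \<lhd> G"
    by (intro normalI subgroup_self) (simp add: coset_join2 coset_join3 subgroup_self)
  then have "group (G Mod carrier G)"
    by (rule normal.factorgroup_is_group)
  moreover have "carrier (G Mod carrier G) = {\<one>\<^bsub>G Mod carrier G\<^esub>}"
    using one_closed by (auto simp: carrier_FactGroup coset_join2 subgroup_self)
  ultimately show ?thesis
    by (simp add: trivial_group_def)
qed

lemma trivial_interval_homology:
  assumes "chain_cycles r x y n = (chain_boundaries r x y n :: ('b list \<Rightarrow>\<^sub>0 'k::comm_ring_1) set)"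
  shows "trivial_group (interval_homology r x y n :: ('b list \<Rightarrow>\<^sub>0 'k) set monoid)"
proof -
  let ?Z = "chain_cycles r x y n :: ('b list \<Rightarrow>\<^sub>0 'k) set"
  let ?G = "\<lparr>carrier = ?Z, monoid.mult = (+), one = 0\<rparr>"
  have add: "u + v \<in> ?Z" if "u \<in> ?Z" "v \<in> ?Z" for u v
    using that Poly_Mapping.keys_add[of u v]
    by (auto simp: chain_cycles_def chain_module_def additive.add[OF additive_chain_boundary])
  have minus: "- u \<in> ?Z" if "u \<in> ?Z" for u
    using that by (auto simp: chain_cycles_def chain_module_def additive.minus[OF additive_chain_boundary])
  have "0 \<in> ?Z"
    by (auto simp: chain_cycles_def chain_module_def additive.zero[OF additive_chain_boundary])
  have "group ?G"
    by (rule groupI) (use add minus \<open>0 \<in> ?Z\<close> in \<open>auto simp: add.assoc intro!: bexI[of _ "- _"]\<close>)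
  then show ?thesis
    using trivial_group_Mod_carrier[of ?G] assms by (simp add: interval_homology_def)
qed

theorem recursive_atom_ordering_cohen_macaulay:
  fixes K :: "'k::comm_ring_1 itself" and \<rho> :: "'b \<Rightarrow> nat"
  assumes "finite (Field r)" "recursive_atom_ordering r as"
    and "\<And>x y. covered_by r x y \<Longrightarrow> \<rho> y = Suc (\<rho> x)"
  shows "cohen_macaulay K (r\<inverse>)"
proof -
  have order: "Partial_order r"
    using assms(2) recursive_atom_ordering_bounded by metis
  have rank: "has_rank (closed_interval (r\<inverse>) x y) n \<longleftrightarrow> n = \<rho> x - \<rho> y" if "(y, x) \<in> r" for x y n
    unfolding closed_interval_converse has_rank_converse
    using has_rank_closed_interval[OF assms(1) order _ that] assms(3) by blast
  have "graded_poset (r\<inverse>)"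
    using order rank by (auto simp: graded_poset_def)
  moreover have "trivial_group (interval_homology (r\<inverse>) x y n :: ('b list \<Rightarrow>\<^sub>0 'k) set monoid)"
    if xy: "(y, x) \<in> r" and n: "n \<noteq> \<rho> x - \<rho> y" for x y n
  proof (rule trivial_interval_homology, cases "x = y")
    case True
    \<comment> \<open>The interval has rank 0, so \<open>n\<close> is positive. No strict chain with
      a positive number of steps returns to \<open>x\<close>, so both chain modules involved are
      zero.\<close>
    have "strict_chains (r\<inverse>) x y m = {}" if "0 < m" for m
    proof -
      have False if xs: "xs \<in> strict_chains (r\<inverse>) x y m" for xs
      proof -
        obtain z zs where "xs = z # zs" "zs \<noteq> []"
          using xs \<open>0 < m\<close> by (cases xs) (auto simp: strict_chains_def)
        then show False
          using xs True last_in_set[of zs] by (auto simp: strict_chains_def strictly_below_def)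
      qed
      then show ?thesis
        by blast
    qed
    then show "chain_cycles (r\<inverse>) x y n = (chain_boundaries (r\<inverse>) x y n :: ('b list \<Rightarrow>\<^sub>0 'k) set)"
      using n True by (auto simp: chain_cycles_def chain_boundaries_def chain_module_def
          additive.zero[OF additive_chain_boundary])
  next
    case False
    then show "chain_cycles (r\<inverse>) x y n = (chain_boundaries (r\<inverse>) x y n :: ('b list \<Rightarrow>\<^sub>0 'k) set)"
      using chains_exact_below_rank[OF assms(1,2) _ xy _ n] assms(3)
      by (intro chain_cycles_eq_boundaries[where K = K]) (use xy in \<open>auto simp: FieldI1 FieldI2\<close>)
  qed
  ultimately show ?thesis
    by (auto simp: cohen_macaulay_def rank)
qed

section \<open>Shellable simplicial complexes\<close>

text \<open>The faces are indexed injectively by \<open>C\<close>; \<open>I p\<close> is the vertex set of the face \<open>p\<close>.\<close>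

lemma distinct_set_singleton: "distinct xs \<Longrightarrow> set xs = {x} \<Longrightarrow> xs = [x]"
  by (cases xs; cases "tl xs") auto

locale shellable_complex =
  fixes C :: "'b set" and I :: "'b \<Rightarrow> 'c set" and N :: nat and fs :: "'b list"
  assumes nonempty: "C \<noteq> {}"
    and inj: "inj_on I C"
    and finite_face: "p \<in> C \<Longrightarrow> finite (I p)"
    and subface: "p \<in> C \<Longrightarrow> A \<subseteq> I p \<Longrightarrow> \<exists>q\<in>C. I q = A"
    and pure: "p \<in> C \<Longrightarrow> \<exists>q\<in>C. I p \<subseteq> I q \<and> card (I q) = N"
    and distinct_facets: "distinct fs"
    and set_facets: "set fs = {p \<in> C. card (I p) = N}"
    and shelling: "j < length fs \<Longrightarrow> i < j \<Longrightarrow>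
      \<exists>l<j. \<exists>a\<in>I (fs ! j). a \<notin> I (fs ! i) \<and> I (fs ! j) - {a} \<subseteq> I (fs ! l)"
begin

text \<open>Reversal makes the added greatest element \<open>None\<close> the bottom, the facets the
  atoms, and the empty face the top.\<close>

definition dual_order :: "'b option rel" where
  "dual_order = (add_greatest {(p, q). p \<in> C \<and> q \<in> C \<and> I p \<subseteq> I q})\<inverse>"

lemma dual_order_iff [simp]:
  "(Some p, Some q) \<in> dual_order \<longleftrightarrow> p \<in> C \<and> q \<in> C \<and> I q \<subseteq> I p"
  "(None, Some q) \<in> dual_order \<longleftrightarrow> q \<in> C"
  "(None, None) \<in> dual_order"
  "(Some p, None) \<notin> dual_order"
  by (auto simp: dual_order_def add_greatest_def Field_def)

lemma Field_dual_order: "Field dual_order = insert None (Some ` C)"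
proof (intro equalityI subsetI)
  fix x assume "x \<in> Field dual_order"
  then obtain y where "(x, y) \<in> dual_order \<or> (y, x) \<in> dual_order"
    by (auto simp: Field_def)
  then show "x \<in> insert None (Some ` C)"
    by (cases x; cases y) auto
next
  fix x assume "x \<in> insert None (Some ` C)"
  then have "(x, x) \<in> dual_order"
    by auto
  then show "x \<in> Field dual_order"
    by (rule FieldI1)
qed

lemma face_eq: "p \<in> C \<Longrightarrow> q \<in> C \<Longrightarrow> I p = I q \<Longrightarrow> p = q"
  using inj by (rule inj_onD) auto

lemma Partial_order_dual_order: "Partial_order dual_order"
  unfolding partial_order_on_def preorder_on_def
proof (intro conjI)
  show "Refl dual_order"
    by (auto simp: refl_on_def Field_dual_order)
  show "dual_order \<subseteq> Field dual_order \<times> Field dual_order"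
    by (auto simp: Field_def)
  show "trans dual_order"
  proof (rule transI)
    fix x y z assume "(x, y) \<in> dual_order" "(y, z) \<in> dual_order"
    then show "(x, z) \<in> dual_order"
      by (cases x; cases y; cases z) auto
  qed
  show "antisym dual_order"
  proof (rule antisymI)
    fix x y assume "(x, y) \<in> dual_order" "(y, x) \<in> dual_order"
    then show "x = y"
      by (cases x; cases y) (auto intro: face_eq)
  qed
qed

lemma card_face_le: "p \<in> C \<Longrightarrow> card (I p) \<le> N"
  using pure[of p] finite_face by (metis card_mono)

text \<open>All subsets of a face are faces, so a cover step removes exactly one vertex.\<close>

lemma covered_by_Some_iff:
  "covered_by dual_order (Some p) x \<longleftrightarrow> p \<in> C \<and> (\<exists>q\<in>C. x = Some q \<and> (\<exists>a\<in>I p. I q = I p - {a}))"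
proof
  assume cov: "covered_by dual_order (Some p) x"
  then obtain q where q: "x = Some q" "p \<in> C" "q \<in> C" "I q \<subseteq> I p" "p \<noteq> q"
    using covered_byD[OF cov] by (cases x) auto
  then obtain a where a: "a \<in> I p" "a \<notin> I q"
    using face_eq by blast
  obtain q' where q': "q' \<in> C" "I q' = I p - {a}"
    using subface[of p "I p - {a}"] q by blast
  then have "Some q' = Some p \<or> Some q' = Some q"
    using cov q a unfolding covered_by_unfold by (metis Diff_subset dual_order_iff(1) subset_Diff_insert Diff_empty)
  then have "q' = q"
    using q' a by auto
  then show "p \<in> C \<and> (\<exists>q\<in>C. x = Some q \<and> (\<exists>a\<in>I p. I q = I p - {a}))"
    using q q' a by blast
next
  assume "p \<in> C \<and> (\<exists>q\<in>C. x = Some q \<and> (\<exists>a\<in>I p. I q = I p - {a}))"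
  then obtain q a where q: "p \<in> C" "x = Some q" "q \<in> C" "a \<in> I p" "I q = I p - {a}"
    by blast
  show "covered_by dual_order (Some p) x"
    unfolding covered_by_unfold
  proof (intro conjI allI impI)
    show "(Some p, x) \<in> dual_order" "Some p \<noteq> x"
      using q by auto
    fix z assume z: "(Some p, z) \<in> dual_order \<and> (z, x) \<in> dual_order"
    then obtain w where w: "z = Some w" "w \<in> C" "I w \<subseteq> I p" "I p - {a} \<subseteq> I w"
      using q by (cases z) auto
    then have "I w = I p \<or> I w = I q"
      using q by blast
    then show "z = Some p \<or> z = x"
      using w q face_eq by blast
  qed
qed

text \<open>By purity every face extends to one with \<open>N\<close> vertices, and no face has
  more.\<close>

lemma covered_by_None_iff: "covered_by dual_order None x \<longleftrightarrow> x \<in> Some ` set fs"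
proof
  assume cov: "covered_by dual_order None x"
  then obtain p where p: "x = Some p" "p \<in> C"
    using covered_byD[OF cov] by (cases x) auto
  then obtain q where "q \<in> C" "I p \<subseteq> I q" "card (I q) = N"
    using pure by blast
  moreover from this have "Some q = None \<or> Some q = Some p"
    using cov p unfolding covered_by_unfold by (metis dual_order_iff(1,2))
  ultimately show "x \<in> Some ` set fs"
    using p by (simp add: set_facets)
next
  assume "x \<in> Some ` set fs"
  then obtain p where p: "x = Some p" "p \<in> C" "card (I p) = N"
    by (auto simp: set_facets)
  show "covered_by dual_order None x"
    unfolding covered_by_unfold
  proof (intro conjI allI impI)
    show "(None, x) \<in> dual_order" "None \<noteq> x"
      using p by auto
    fix z assume z: "(None, z) \<in> dual_order \<and> (z, x) \<in> dual_order"
    show "z = None \<or> z = x"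
    proof (cases z)
      case (Some w)
      then have "w \<in> C" "I p \<subseteq> I w"
        using z p by auto
      then have "I p = I w"
        using p card_face_le finite_face by (metis card_seteq)
      then show ?thesis
        using Some p \<open>w \<in> C\<close> face_eq by blast
    qed simp
  qed
qed

text \<open>Codimension shifted by one, which leaves rank 0 for \<open>None\<close>. Faces have at
  most \<open>N\<close> vertices, so the truncated subtraction is exact and facets get rank
  1.\<close>

lemma covered_by_dual_order_rank:
  assumes "covered_by dual_order x y"
  shows "(case y of None \<Rightarrow> 0 | Some p \<Rightarrow> Suc N - card (I p)) =
    Suc (case x of None \<Rightarrow> 0 | Some p \<Rightarrow> Suc N - card (I p))"
proof (cases x)
  case None
  then show ?thesis
    using assms by (auto simp: covered_by_None_iff set_facets)
next
  case (Some p)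
  then obtain q a where "p \<in> C" "y = Some q" "a \<in> I p" "I q = I p - {a}"
    using assms covered_by_Some_iff by blast
  moreover from this have "0 < card (I p)" "card (I q) = card (I p) - 1" "card (I p) \<le> N"
    using finite_face[of p] card_face_le[of p] by (auto simp: card_gt_0_iff)
  ultimately show ?thesis
    using Some by simp
qed

text \<open>Any ordering of the atoms of a Boolean interval is recursive, so the list may begin with
  whichever atoms condition (1) prescribes.\<close>

lemma obtain_list_with_initial_segment:
  assumes "finite A" "D \<subseteq> A"
  obtains bs m where "distinct bs" "set bs = A" "set (take m bs) = D"
proof -
  obtain xs ys where "set xs = D" "distinct xs" "set ys = A - D" "distinct ys"
    using assms by (metis finite_Diff finite_distinct_list finite_subset)
  then show ?thesis
    using that[of "xs @ ys" "length xs"] assms(2) by auto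
qed

lemma finite_covered_by: "p \<in> C \<Longrightarrow> finite {x. covered_by dual_order (Some p) x}"
proof -
  assume p: "p \<in> C"
  have "{x. covered_by dual_order (Some p) x} \<subseteq>
    (\<lambda>a. Some (the_inv_into C I (I p - {a}))) ` I p"
    using the_inv_into_f_f[OF inj] by (force simp: covered_by_Some_iff image_iff)
  then show ?thesis
    using finite_face[OF p] by (meson finite_imageI finite_subset)
qed

text \<open>The upper intervals of proper elements are Boolean, so any two atoms have a join of rank two.\<close>

lemma recursive_atom_ordering_face:
  assumes "p \<in> C" "I p \<noteq> {}" "e \<in> C" "I e = {}"
    and "distinct as" "set as = {x. covered_by dual_order (Some p) x}"
  shows "recursive_atom_ordering (closed_interval dual_order (Some p) (Some e)) as"
  using assms
proof (induction "card (I p)" arbitrary: p as rule: less_induct)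
  case less
  let ?s = "closed_interval dual_order (Some p) (Some e)"
  note order = Partial_order_dual_order
  have pe: "(Some p, Some e) \<in> dual_order"
    using less.prems by auto
  note bounds = least_elem_closed_interval[OF order pe]
  have Field: "Field ?s = {Some q | q. q \<in> C \<and> I q \<subseteq> I p}"
  proof (rule Set.set_eqI)
    fix x
    show "x \<in> Field ?s \<longleftrightarrow> x \<in> {Some q | q. q \<in> C \<and> I q \<subseteq> I p}"
      using less.prems by (cases x) (auto simp: Field_closed_interval[OF order])
  qed
  have cov: "covered_by ?s x y \<longleftrightarrow> covered_by dual_order x y"
    if "(Some p, x) \<in> dual_order" for x y
  proof -
    have "(y, Some e) \<in> dual_order" if "covered_by dual_order x y"
      using that \<open>(Some p, x) \<in> dual_order\<close> less.prems covered_byD[OF that]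
      by (cases x; cases y) auto
    then show ?thesis
      using that by (auto simp: covered_by_closed_interval[OF order])
  qed
  show ?case
  proof (cases "\<exists>a. I p = {a}")
    case True
    \<comment> \<open>A face with one vertex spans a two-element interval, where the recursion
      ends.\<close>
    then obtain a where a: "I p = {a}"
      by blast
    have e_unique: "q = e" if "q \<in> C" "I q = {}" for q
      using that less.prems face_eq by metis
    have "covered_by dual_order (Some p) x \<longleftrightarrow> x = Some e" for x
    proof
      assume "covered_by dual_order (Some p) x"
      then obtain q where "x = Some q" "q \<in> C" "I q = {}"
        using a by (auto simp: covered_by_Some_iff)
      then show "x = Some e"
        using e_unique by blast
    qed (use a \<open>p \<in> C\<close> \<open>e \<in> C\<close> \<open>I e = {}\<close> in \<open>auto simp: covered_by_Some_iff\<close>)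
    then have "{x. covered_by dual_order (Some p) x} = {Some e}"
      by simp
    then have "as = [Some e]"
      using less.prems distinct_set_singleton by metis
    moreover have "Field ?s = {Some p, Some e}"
    proof -
      have "q = p \<or> q = e" if "q \<in> C" "I q \<subseteq> I p" for q
        using that a less.prems face_eq subset_singletonD by metis
      then show ?thesis
        using less.prems by (auto simp: Field)
    qed
    moreover have "Some p \<noteq> Some e"
      using less.prems by auto
    ultimately show ?thesis
      using bounds Partial_order_closed_interval[OF order] recursive_atom_ordering.two_elements by metis
  next
    case False
    obtain a where a: "a \<in> I p"
      using less.prems by blast
    obtain q where q: "q \<in> C" "I q = I p - {a}"
      using subface[of p "I p - {a}"] less.prems by blast
    show ?thesis
    proof (rule recursive_atom_ordering.at_least_three_elements[OF _ bounds])
      show "Partial_order ?s"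
        by (rule Partial_order_closed_interval[OF order])
      have "I q \<noteq> {}" "I q \<noteq> I p"
        using False a q by auto
      then show "\<exists>x\<in>Field ?s. x \<noteq> Some p \<and> x \<noteq> Some e"
        unfolding Field using q(1) q(2) \<open>I e = {}\<close> by (intro bexI[of _ "Some q"]) auto
      show "Some p \<noteq> Some e"
        using less.prems by auto
      show "distinct as"
        by fact
      show "set as = {a. covered_by ?s (Some p) a}"
        using less.prems cov by simp
      show "\<forall>j<length as. \<exists>bs. recursive_atom_ordering (closed_interval ?s (as ! j) (Some e)) bs \<and>
          (\<exists>m. set (take m bs) = {c \<in> set bs. \<exists>i<j. covered_by ?s (as ! i) c})"
      proof (intro allI impI)
        fix j assume "j < length as"
        then have "covered_by dual_order (Some p) (as ! j)"
          using less.prems by (metis mem_Collect_eq nth_mem)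
        then obtain q a where q: "as ! j = Some q" "q \<in> C" "a \<in> I p" "I q = I p - {a}"
          by (auto simp: covered_by_Some_iff)
        let ?A = "{x. covered_by dual_order (Some q) x}"
        obtain bs m where bs: "distinct bs" "set bs = ?A"
          "set (take m bs) = {c \<in> ?A. \<exists>i<j. covered_by ?s (as ! i) c}"
          using obtain_list_with_initial_segment[OF finite_covered_by[OF q(2)],
              of "{c \<in> ?A. \<exists>i<j. covered_by ?s (as ! i) c}"] by auto
        have "card (I q) < card (I p)"
          using card_Diff1_less[OF finite_face[OF \<open>p \<in> C\<close>] q(3)] q(4) by simp
        moreover have "I q \<noteq> {}"
          using False q by auto
        ultimately have "recursive_atom_ordering (closed_interval dual_order (Some q) (Some e)) bs"
          using less.hyps q less.prems bs by blast
        moreover have "closed_interval ?s (Some q) (Some e) = closed_interval dual_order (Some q) (Some e)"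
          by (rule closed_interval_closed_interval[OF order]) (use q less.prems in auto)
        ultimately show "\<exists>bs. recursive_atom_ordering (closed_interval ?s (as ! j) (Some e)) bs \<and>
            (\<exists>m. set (take m bs) = {c \<in> set bs. \<exists>i<j. covered_by ?s (as ! i) c})"
          by (intro exI[of _ bs] exI[of _ m] conjI) (use bs q in simp_all)
      qed
      show "\<forall>j<length as. \<forall>i<j. \<forall>y. strictly_below ?s (as ! i) y \<and> strictly_below ?s (as ! j) y \<longrightarrow>
          (\<exists>l<j. \<exists>z. covered_by ?s (as ! l) z \<and> covered_by ?s (as ! j) z \<and> (z, y) \<in> ?s)"
      proof (intro allI impI)
        fix j i y
        assume ij: "j < length as" "i < j"
          and y: "strictly_below ?s (as ! i) y \<and> strictly_below ?s (as ! j) y"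
        have "covered_by dual_order (Some p) (as ! i)" "covered_by dual_order (Some p) (as ! j)"
          using less.prems ij by (metis mem_Collect_eq nth_mem order.strict_trans)+
        then obtain q a q' a' where q: "as ! i = Some q" "q \<in> C" "a \<in> I p" "I q = I p - {a}"
          and q': "as ! j = Some q'" "q' \<in> C" "a' \<in> I p" "I q' = I p - {a'}"
          by (auto simp: covered_by_Some_iff)
        have "as ! i \<noteq> as ! j"
          using ij less.prems by (simp add: nth_eq_iff_index_eq)
        then have "a \<noteq> a'"
          using q q' face_eq by metis
        \<comment> \<open>A face contained in both \<open>I q\<close> and \<open>I q'\<close> avoids
          \<open>a\<close> and \<open>a'\<close>, so it is contained in \<open>I z\<close>.\<close>
        obtain z where z: "z \<in> C" "I z = I p - {a, a'}"
          using subface[of p "I p - {a, a'}"] less.prems by blast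
        obtain w where w: "y = Some w" "w \<in> C" "I w \<subseteq> I q" "I w \<subseteq> I q'"
        proof (cases y)
          case None
          then show ?thesis
            using y q by (auto simp: strictly_below_def closed_interval_iff)
        next
          case (Some w)
          then show ?thesis
            using y q q' that by (auto simp: strictly_below_def closed_interval_iff)
        qed
        have "a' \<in> I q" "I z = I q - {a'}" "a \<in> I q'" "I z = I q' - {a}"
          using q(3,4) q'(3,4) z(2) \<open>a \<noteq> a'\<close> by auto
        then have "covered_by dual_order (Some q) (Some z)" "covered_by dual_order (Some q') (Some z)"
          using q(2) q'(2) z(1) unfolding covered_by_Some_iff by blast+
        then have "covered_by ?s (as ! i) (Some z)" "covered_by ?s (as ! j) (Some z)"
          using q q' \<open>p \<in> C\<close> by (simp_all add: cov)
        moreover have "(Some z, y) \<in> ?s"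
          using w z q q' less.prems by (auto simp: closed_interval_iff)
        ultimately show "\<exists>l<j. \<exists>z. covered_by ?s (as ! l) z \<and> covered_by ?s (as ! j) z \<and> (z, y) \<in> ?s"
          using ij by blast
      qed
    qed
  qed
qed

text \<open>Condition (1) is free because the intervals above facets are Boolean. Condition (2) is
  the shelling property.\<close>

theorem recursive_atom_ordering_dual_order: "recursive_atom_ordering dual_order (map Some fs)"
proof -
  note order = Partial_order_dual_order
  obtain e where e: "e \<in> C" "I e = {}"
    using nonempty subface by blast
  have least: "least_elem dual_order None"
    by (auto simp: least_elem_def Field_dual_order)
  have greatest: "greatest_elem dual_order (Some e)"
    using e by (auto simp: greatest_elem_def Field_dual_order)
  obtain f where f: "f \<in> C" "card (I f) = N"
    using pure e by blast
  show ?thesis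
  proof (cases "N = 0")
    case True
    \<comment> \<open>The empty face is the only one, so the poset has two elements and the first
      clause of the definition is needed.\<close>
    have "q = e" if "q \<in> C" for q
      using card_face_le[OF that] finite_face[OF that] True e that face_eq by simp
    then have "C = {e}"
      using e by blast
    then have "set fs = {e}"
      using True e by (auto simp: set_facets)
    then have "fs = [e]"
      using distinct_facets distinct_set_singleton by metis
    moreover have "Some ` C = {Some e}"
      using \<open>C = {e}\<close> by blast
    then have "Field dual_order = {None, Some e}"
      by (simp only: Field_dual_order)
    ultimately show ?thesis
      using recursive_atom_ordering.two_elements[OF order least greatest] by simp
  next
    case False
    have facet: "fs ! j \<in> C" "card (I (fs ! j)) = N" if "j < length fs" for j
      using that set_facets nth_mem by blast+
    show ?thesis
    proof (rule recursive_atom_ordering.at_least_three_elements[OF order least greatest])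
      show "\<exists>x\<in>Field dual_order. x \<noteq> None \<and> x \<noteq> Some e"
        using f e False by (intro bexI[of _ "Some f"]) (auto simp: Field_dual_order)
      show "None \<noteq> Some e"
        by simp
      show "distinct (map Some fs)"
        using distinct_facets by (simp add: distinct_map)
      show "set (map Some fs) = {a. covered_by dual_order None a}"
        by (simp add: covered_by_None_iff)
      show "\<forall>j<length (map Some fs). \<exists>bs.
          recursive_atom_ordering (closed_interval dual_order (map Some fs ! j) (Some e)) bs \<and>
          (\<exists>m. set (take m bs) = {c \<in> set bs. \<exists>i<j. covered_by dual_order (map Some fs ! i) c})"
      proof (intro allI impI)
        fix j assume j: "j < length (map Some fs)"
        let ?A = "{x. covered_by dual_order (Some (fs ! j)) x}"
        obtain bs m where bs: "distinct bs" "set bs = ?A"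
          "set (take m bs) = {c \<in> ?A. \<exists>i<j. covered_by dual_order (map Some fs ! i) c}"
          using obtain_list_with_initial_segment[OF finite_covered_by,
              of "fs ! j" "{c \<in> ?A. \<exists>i<j. covered_by dual_order (map Some fs ! i) c}"] facet j by auto
        have "recursive_atom_ordering (closed_interval dual_order (Some (fs ! j)) (Some e)) bs"
          by (rule recursive_atom_ordering_face) (use facet[of j] j e bs False in auto)
        then show "\<exists>bs. recursive_atom_ordering (closed_interval dual_order (map Some fs ! j) (Some e)) bs \<and>
          (\<exists>m. set (take m bs) = {c \<in> set bs. \<exists>i<j. covered_by dual_order (map Some fs ! i) c})"
          by (intro exI[of _ bs] exI[of _ m] conjI) (use bs j in simp_all)
      qed
      show "\<forall>j<length (map Some fs). \<forall>i<j. \<forall>y. strictly_below dual_order (map Some fs ! i) y \<and>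
          strictly_below dual_order (map Some fs ! j) y \<longrightarrow>
          (\<exists>l<j. \<exists>z. covered_by dual_order (map Some fs ! l) z \<and>
            covered_by dual_order (map Some fs ! j) z \<and> (z, y) \<in> dual_order)"
      proof (intro allI impI)
        fix j i y
        assume j: "j < length (map Some fs)" and "i < j" and y: "strictly_below dual_order (map Some fs ! i) y \<and>
          strictly_below dual_order (map Some fs ! j) y"
        then obtain w where w: "y = Some w" "w \<in> C" "I w \<subseteq> I (fs ! i)" "I w \<subseteq> I (fs ! j)"
          by (cases y) (auto simp: strictly_below_def)
        \<comment> \<open>As \<open>a\<close> is missing from the facet with index \<open>i\<close>,
          a face \<open>w\<close> common to both facets avoids \<open>a\<close> and stays inside the
          facet with index \<open>j\<close> without \<open>a\<close>.\<close>
        obtain l a where l: "l < j" "a \<in> I (fs ! j)" "a \<notin> I (fs ! i)" "I (fs ! j) - {a} \<subseteq> I (fs ! l)"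
          using shelling \<open>i < j\<close> j by (metis length_map)
        obtain z where z: "z \<in> C" "I z = I (fs ! j) - {a}"
          using subface[of "fs ! j" "I (fs ! j) - {a}"] facet j by auto
        \<comment> \<open>\<open>z\<close> has \<open>N - 1\<close> vertices, all of them in the
          facet with index \<open>l\<close>; hence that facet has just one more, and
          \<open>z\<close> covers it in the reversed order.\<close>
        have "card (I (fs ! l) - I z) = 1"
          using l z facet[of j] facet[of l] j finite_face[of "fs ! j"] finite_face[of "fs ! l"] False
          by (subst card_Diff_subset) auto
        then obtain a' where "I (fs ! l) - I z = {a'}"
          by (rule card_1_singletonE)
        then have "I z = I (fs ! l) - {a'}" "a' \<in> I (fs ! l)"
          using l z by blast+
        then have "covered_by dual_order (Some (fs ! l)) (Some z)"
          using facet[of l] l j z by (auto simp: covered_by_Some_iff)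
        moreover have "covered_by dual_order (Some (fs ! j)) (Some z)"
          using facet[of j] l j z by (auto simp: covered_by_Some_iff)
        moreover have "(Some z, y) \<in> dual_order"
          using w z l by auto
        ultimately show "\<exists>l<j. \<exists>z. covered_by dual_order (map Some fs ! l) z \<and>
            covered_by dual_order (map Some fs ! j) z \<and> (z, y) \<in> dual_order"
          using l(1) j by (intro exI[of _ l] conjI exI[of _ "Some z"]) simp_all
      qed
    qed
  qed
qed

lemma dual_order_cohen_macaulay:
  assumes "finite C"
  shows "cohen_macaulay K (dual_order\<inverse>)"
  by (rule recursive_atom_ordering_cohen_macaulay[OF _ recursive_atom_ordering_dual_order,
        where \<rho> = "\<lambda>x. case x of None \<Rightarrow> 0 | Some p \<Rightarrow> Suc N - card (I p)"])
    (use assms covered_by_dual_order_rank in \<open>auto simp: Field_dual_order\<close>)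

end

section \<open>Set compositions as flags of subsets\<close>

primrec initial_unions :: "'a set \<Rightarrow> 'a set list \<Rightarrow> 'a set set" where
  "initial_unions A [] = {}"
| "initial_unions A (B # p) = insert (A \<union> B) (initial_unions (A \<union> B) p)"

text \<open>The accumulator \<open>A\<close> holds the union of the blocks already read, so
  disjointness is checked along the same recursion that forms the initial unions.\<close>

primrec blocks_off :: "'a set \<Rightarrow> 'a set list \<Rightarrow> bool" where
  "blocks_off A [] \<longleftrightarrow> True"
| "blocks_off A (B # p) \<longleftrightarrow> B \<noteq> {} \<and> A \<inter> B = {} \<and> blocks_off (A \<union> B) p"

lemma blocks_off_disjoint: "blocks_off A p \<Longrightarrow> A \<inter> \<Union>(set p) = {}"
  by (induction p arbitrary: A) (simp, fastforce)

text \<open>For nonempty blocks, disjointness from all later blocks already includes being different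
  from them.\<close>

lemma blocks_off_iff:
  "blocks_off A p \<longleftrightarrow> distinct p \<and> {} \<notin> set p \<and> disjoint (set p) \<and> A \<inter> \<Union>(set p) = {}"
proof (induction p arbitrary: A)
  case (Cons B p)
  have "B \<notin> set p \<and> disjoint (insert B (set p)) \<longleftrightarrow> B \<inter> \<Union>(set p) = {} \<and> disjoint (set p)"
    if "B \<noteq> {}"
    using that by (auto simp: pairwise_insert disjnt_def)
  then show ?case
    using Cons.IH[of "A \<union> B"] by auto
qed simp

lemma set_compositions_iff: "p \<in> set_compositions S \<longleftrightarrow> blocks_off {} p \<and> \<Union>(set p) = S"
  by (auto simp: set_compositions_def partition_on_def blocks_off_iff)

lemma blocks_off_append: "blocks_off A (p @ q) \<longleftrightarrow> blocks_off A p \<and> blocks_off (A \<union> \<Union>(set p)) q"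
  by (induction p arbitrary: A) (auto simp: Un_assoc)

lemma initial_unions_append:
  "initial_unions A (p @ q) = initial_unions A p \<union> initial_unions (A \<union> \<Union>(set p)) q"
  by (induction p arbitrary: A) (auto simp: Un_assoc)

lemma initial_unions_bounds: "X \<in> initial_unions A p \<Longrightarrow> A \<subseteq> X \<and> X \<subseteq> A \<union> \<Union>(set p)"
  by (induction p arbitrary: A) (simp, fastforce)

lemma total_in_initial_unions: "p \<noteq> [] \<Longrightarrow> A \<union> \<Union>(set p) \<in> initial_unions A p"
proof (induction p arbitrary: A)
  case (Cons B p)
  then show ?case
    using Cons.IH[of "A \<union> B"] by (cases p) (auto simp: Un_assoc)
qed simp

lemma initial_unions_split:
  assumes "X \<in> initial_unions A p"
  obtains g q where "p = g @ q" "g \<noteq> []" "X = A \<union> \<Union>(set g)"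
proof -
  have "\<exists>g q. p = g @ q \<and> g \<noteq> [] \<and> X = A \<union> \<Union>(set g)"
    using assms
  proof (induction p arbitrary: A)
    case (Cons B p)
    show ?case
    proof (cases "X = A \<union> B")
      case True
      then show ?thesis
        by (intro exI[of _ "[B]"] exI[of _ p]) simp
    next
      case False
      then have "X \<in> initial_unions (A \<union> B) p"
        using Cons.prems by simp
      then obtain g q where "p = g @ q" "X = A \<union> B \<union> \<Union>(set g)"
        using Cons.IH by blast
      then show ?thesis
        by (intro exI[of _ "B # g"] exI[of _ q]) (simp add: Un_assoc)
    qed
  qed simp
  then show ?thesis
    using that by blast
qed

text \<open>The first block alone adds a point outside \<open>A\<close>.\<close>

lemma initial_unions_not_subset:
  assumes "blocks_off A p" "X \<in> initial_unions A p"
  shows "\<not> X \<subseteq> A"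
proof -
  obtain g q where gq: "p = g @ q" "g \<noteq> []" "X = A \<union> \<Union>(set g)"
    using assms(2) by (rule initial_unions_split)
  then obtain B g' where "g = B # g'"
    by (cases g) auto
  then show ?thesis
    using assms(1) gq by auto
qed

lemma card_initial_unions: "blocks_off A p \<Longrightarrow> finite (initial_unions A p) \<and> card (initial_unions A p) = length p"
proof (induction p arbitrary: A)
  case (Cons B p)
  then have "A \<union> B \<notin> initial_unions (A \<union> B) p"
    using initial_unions_not_subset[of "A \<union> B" p "A \<union> B"] by auto
  then show ?case
    using Cons by simp
qed simp

text \<open>The unions that survive merging are those reached at the end of a group.\<close>

lemma merges_to_initial_unions:
  assumes "merges_to q p"
  shows "initial_unions A p \<subseteq> initial_unions A q"
proof -
  have "initial_unions A (map (\<lambda>g. \<Union>(set g)) gs) \<subseteq> initial_unions A (concat gs)"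
    if "[] \<notin> set gs" for gs :: "'a set list list"
    using that
  proof (induction gs arbitrary: A)
    case (Cons g gs)
    then have "initial_unions (A \<union> \<Union>(set g)) (map (\<lambda>g. \<Union>(set g)) gs)
        \<subseteq> initial_unions (A \<union> \<Union>(set g)) (concat gs)"
      by simp
    then show ?case
      using total_in_initial_unions[of g A] Cons.prems by (auto simp: initial_unions_append)
  qed simp
  then show ?thesis
    using assms by (auto simp: merges_to_def)
qed

text \<open>For the first block \<open>B\<close> of \<open>p\<close>, the set
  \<open>A \<union> B\<close> cuts off a prefix \<open>g\<close> of \<open>q\<close> with union
  \<open>B\<close>; this is the first group. Unions formed inside \<open>g\<close> stay within
  \<open>A \<union> B\<close>, whereas the later unions of \<open>p\<close> leave it, so the
  inclusion passes to the remainders.\<close>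

lemma merges_to_if_initial_unions:
  assumes "blocks_off A p" "blocks_off A q" "\<Union>(set p) = \<Union>(set q)"
    and "initial_unions A p \<subseteq> initial_unions A q"
  shows "merges_to q p"
  using assms
proof (induction p arbitrary: A q)
  case Nil
  then have "q = []"
    by (cases q) auto
  then show ?case
    by (auto simp: merges_to_def)
next
  case (Cons B p)
  then have "A \<union> B \<in> initial_unions A q"
    by simp
  then obtain g q' where q: "q = g @ q'" "g \<noteq> []" "A \<union> B = A \<union> \<Union>(set g)"
    by (rule initial_unions_split)
  have "A \<inter> B = {}" "A \<inter> \<Union>(set g) = {}"
    using Cons.prems q blocks_off_disjoint[of A q] by auto
  then have B: "B = \<Union>(set g)"
    using q(3) by blast
  have p: "blocks_off (A \<union> B) p" and q': "blocks_off (A \<union> B) q'"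
    using Cons.prems q B by (auto simp: blocks_off_append)
  have "merges_to q' p"
  proof (rule Cons.IH[OF p q'])
    have "B \<inter> \<Union>(set p) = {}" "B \<inter> \<Union>(set q') = {}"
      using blocks_off_disjoint[OF p] blocks_off_disjoint[OF q'] by auto
    moreover have "B \<union> \<Union>(set p) = B \<union> \<Union>(set q')"
      using Cons.prems(3) q(1) B by simp
    ultimately show "\<Union>(set p) = \<Union>(set q')"
      by blast
    show "initial_unions (A \<union> B) p \<subseteq> initial_unions (A \<union> B) q'"
    proof
      fix X assume X: "X \<in> initial_unions (A \<union> B) p"
      then have "X \<in> initial_unions A g \<union> initial_unions (A \<union> B) q'"
        using Cons.prems(4) q B by (auto simp: initial_unions_append)
      moreover have "X \<notin> initial_unions A g"
        using initial_unions_not_subset[OF p X] initial_unions_bounds[of X A g] B by blast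
      ultimately show "X \<in> initial_unions (A \<union> B) q'"
        by blast
    qed
  qed
  then obtain gs where "[] \<notin> set gs" "concat gs = q'" "p = map (\<lambda>g. \<Union>(set g)) gs"
    by (auto simp: merges_to_def)
  then show ?case
    unfolding merges_to_def using q B by (intro exI[of _ "g # gs"]) auto
qed

text \<open>Every group contains a block, and equal lengths force groups of one block, which merging
  does not change. Equality of compositions is later read off from lengths in this way.\<close>

lemma merges_to_length:
  assumes "merges_to q p"
  shows "length p \<le> length q" "length p = length q \<Longrightarrow> p = q"
proof -
  have "length gs \<le> length (concat gs) \<and>
      (length gs = length (concat gs) \<longrightarrow> map (\<lambda>g. \<Union>(set g)) gs = concat gs)"
    if "[] \<notin> set gs" for gs :: "'a set list list"
    using that
  proof (induction gs)
    case (Cons g gs)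
    then obtain B g' where "g = B # g'"
      by (cases g) auto
    then show ?case
      using Cons by (cases g') auto
  qed simp
  then show "length p \<le> length q" "length p = length q \<Longrightarrow> p = q"
    using assms by (auto simp: merges_to_def)
qed

text \<open>The cut after a block is kept exactly when the union up to there belongs to
  \<open>F\<close>; otherwise the block joins the following group. The cut at the very end cannot be
  dropped, hence the second assumption.\<close>

lemma subset_initial_unions_merge:
  assumes "F \<subseteq> initial_unions A q" "q \<noteq> [] \<Longrightarrow> A \<union> \<Union>(set q) \<in> F"
  shows "\<exists>gs. [] \<notin> set gs \<and> concat gs = q \<and> initial_unions A (map (\<lambda>g. \<Union>(set g)) gs) = F"
  using assms
proof (induction q arbitrary: A F)
  case Nil
  then show ?case
    by (intro exI[of _ "[]"]) auto
next
  case (Cons B q)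
  show ?case
  proof (cases "q = []")
    case True
    then show ?thesis
      using Cons.prems by (intro exI[of _ "[[B]]"]) auto
  next
    case False
    let ?F = "F \<inter> initial_unions (A \<union> B) q"
    have "A \<union> B \<union> \<Union>(set q) \<in> ?F"
      using Cons.prems(2) total_in_initial_unions[OF False, of "A \<union> B"] by (simp add: Un_assoc)
    then obtain gs where gs: "[] \<notin> set gs" "concat gs = q"
      "initial_unions (A \<union> B) (map (\<lambda>g. \<Union>(set g)) gs) = ?F"
      using Cons.IH[of ?F "A \<union> B"] by auto
    then obtain g gs' where g: "gs = g # gs'"
      using False by (cases gs) auto
    show ?thesis
    proof (cases "A \<union> B \<in> F")
      case True
      then show ?thesis
        using gs Cons.prems(1) by (intro exI[of _ "[B] # gs"]) auto
    next
      case False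
      then have "F = ?F"
        using Cons.prems(1) by auto
      then show ?thesis
        using gs g by (intro exI[of _ "(B # g) # gs'"]) (auto simp: Un_assoc)
    qed
  qed
qed

lemma blocks_off_merge:
  "[] \<notin> set gs \<Longrightarrow> blocks_off A (concat gs) \<Longrightarrow> blocks_off A (map (\<lambda>g. \<Union>(set g)) gs)"
proof (induction gs arbitrary: A)
  case (Cons g gs)
  then obtain B g' where "g = B # g'"
    by (cases g) auto
  then have "\<Union>(set g) \<noteq> {}"
    using Cons.prems by (auto simp: blocks_off_append)
  then show ?case
    using Cons blocks_off_disjoint[of A g] by (simp add: blocks_off_append)
qed simp

lemma Union_merge: "\<Union>(set (map (\<lambda>g. \<Union>(set g)) gs)) = \<Union>(set (concat gs))"
  by auto

section \<open>Linear orderings and flags\<close>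

abbreviation singletons :: "'a list \<Rightarrow> 'a set list" where
  "singletons w \<equiv> map (\<lambda>x. {x}) w"

lemma blocks_off_singletons: "blocks_off A (singletons w) \<longleftrightarrow> distinct w \<and> A \<inter> set w = {}"
  by (induction w arbitrary: A) auto

lemma singletons_in_set_compositions:
  "singletons w \<in> set_compositions S \<longleftrightarrow> distinct w \<and> set w = S"
  by (auto simp: set_compositions_iff blocks_off_singletons)

text \<open>Order each block arbitrarily and concatenate. This yields purity of the complex.\<close>

lemma refine_to_singletons:
  assumes "blocks_off A p" "finite (\<Union>(set p))"
  shows "\<exists>w. distinct w \<and> set w = \<Union>(set p) \<and> merges_to (singletons w) p"
  using assms
proof (induction p arbitrary: A)
  case Nil
  then show ?case
    by (intro exI[of _ "[]"]) (auto simp: merges_to_def)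
next
  case (Cons B p)
  then obtain w where w: "distinct w" "set w = \<Union>(set p)" "merges_to (singletons w) p"
    using Cons.IH[of "A \<union> B"] by auto
  then obtain gs where gs: "[] \<notin> set gs" "concat gs = singletons w" "p = map (\<lambda>g. \<Union>(set g)) gs"
    by (auto simp: merges_to_def)
  obtain l where l: "set l = B" "distinct l"
    using Cons.prems finite_distinct_list by auto
  have "B \<inter> \<Union>(set p) = {}"
    using Cons.prems blocks_off_disjoint[of "A \<union> B" p] by auto
  moreover have "l \<noteq> []"
    using Cons.prems l by auto
  then have "merges_to (singletons (l @ w)) (B # p)"
    unfolding merges_to_def using gs l by (intro exI[of _ "singletons l # gs"]) auto
  ultimately show ?case
    using w l by (intro exI[of _ "l @ w"]) auto
qed

text \<open>For nonempty \<open>S\<close> the total union \<open>S\<close> occurs for every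
  composition and carries no information. Without it the composition with one block becomes the
  empty face.\<close>

definition flag :: "'a set \<Rightarrow> 'a set list \<Rightarrow> 'a set set" where
  "flag S p = initial_unions {} p - {S}"

lemma set_compositions_nonempty_list: "S \<noteq> {} \<Longrightarrow> p \<in> set_compositions S \<Longrightarrow> p \<noteq> []"
  by (auto simp: set_compositions_iff)

lemma initial_unions_eq_flag:
  assumes "S \<noteq> {}" "p \<in> set_compositions S"
  shows "initial_unions {} p = insert S (flag S p)"
  using total_in_initial_unions[OF set_compositions_nonempty_list[OF assms], of "{}"] assms(2)
  by (auto simp: flag_def set_compositions_iff)

lemma merges_to_iff_flag:
  assumes "S \<noteq> {}" "p \<in> set_compositions S" "q \<in> set_compositions S"
  shows "merges_to q p \<longleftrightarrow> flag S p \<subseteq> flag S q"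
proof
  assume "merges_to q p"
  then show "flag S p \<subseteq> flag S q"
    using merges_to_initial_unions[of q p "{}"] by (auto simp: flag_def)
next
  assume "flag S p \<subseteq> flag S q"
  then have "initial_unions {} p \<subseteq> initial_unions {} q"
    using initial_unions_eq_flag[OF assms(1,2)] initial_unions_eq_flag[OF assms(1,3)] by auto
  then show "merges_to q p"
    using assms by (intro merges_to_if_initial_unions) (auto simp: set_compositions_iff)
qed

lemma card_flag:
  assumes "S \<noteq> {}" "p \<in> set_compositions S"
  shows "finite (flag S p)" "Suc (card (flag S p)) = length p"
proof -
  have "S \<notin> flag S p"
    by (simp add: flag_def)
  moreover have "finite (initial_unions {} p)" "card (initial_unions {} p) = length p"
    using card_initial_unions[of "{}" p] assms(2) by (auto simp: set_compositions_iff)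
  ultimately show "finite (flag S p)" "Suc (card (flag S p)) = length p"
    using initial_unions_eq_flag[OF assms] by auto
qed

text \<open>Equal flags give a merging between lists of equal length, since the flag determines the
  number of blocks.\<close>

lemma flag_inj:
  assumes "S \<noteq> {}"
  shows "inj_on (flag S) (set_compositions S)"
proof (rule inj_onI)
  fix p q assume p: "p \<in> set_compositions S" and q: "q \<in> set_compositions S" and eq: "flag S p = flag S q"
  then have "merges_to q p"
    using merges_to_iff_flag[OF assms] by blast
  moreover have "length p = length q"
    using card_flag(2)[OF assms] p q eq by metis
  ultimately show "p = q"
    using merges_to_length by blast
qed

lemma subset_flag:
  assumes "S \<noteq> {}" "q \<in> set_compositions S" "F \<subseteq> flag S q"
  shows "\<exists>p\<in>set_compositions S. flag S p = F"
proof -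
  have "insert S F \<subseteq> initial_unions {} q"
    using initial_unions_eq_flag[OF assms(1,2)] assms(3) by auto
  moreover have "{} \<union> \<Union>(set q) \<in> insert S F"
    using assms(2) by (simp add: set_compositions_iff)
  ultimately obtain gs where gs: "[] \<notin> set gs" "concat gs = q"
    "initial_unions {} (map (\<lambda>g. \<Union>(set g)) gs) = insert S F"
    using subset_initial_unions_merge by metis
  have "map (\<lambda>g. \<Union>(set g)) gs \<in> set_compositions S"
    using blocks_off_merge[OF gs(1), of "{}"] gs(2) Union_merge[of gs] assms(2)
    by (simp add: set_compositions_iff)
  moreover have "S \<notin> F"
    using assms(3) by (auto simp: flag_def)
  then have "flag S (map (\<lambda>g. \<Union>(set g)) gs) = F"
    using gs(3) by (simp add: flag_def)
  ultimately show ?thesis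
    by blast
qed

section \<open>The lexicographic shelling\<close>

text \<open>If no two neighbours formed a descent, the values would increase weakly from
  \<open>a\<close> to \<open>b\<close>.\<close>

lemma descent_exists:
  fixes f :: "'a \<Rightarrow> 'l::linorder"
  assumes "f b < f a"
  shows "\<exists>xs c d zs. a # ys @ [b] = xs @ c # d # zs \<and> f d < f c"
  using assms
proof (induction ys arbitrary: a)
  case Nil
  then show ?case
    by (intro exI[of _ "[]"] exI[of _ a] exI[of _ b] exI[of _ "[]"]) simp
next
  case (Cons y ys)
  show ?case
  proof (cases "f y < f a")
    case True
    then show ?thesis
      by (intro exI[of _ "[]"] exI[of _ a] exI[of _ y] exI[of _ "ys @ [b]"]) simp
  next
    case False
    then have "f b < f y"
      using Cons.prems by simp
    then obtain xs c d zs where "y # ys @ [b] = xs @ c # d # zs" "f d < f c"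
      using Cons.IH by blast
    then show ?thesis
      by (intro exI[of _ "a # xs"] exI[of _ c] exI[of _ d] exI[of _ zs]) simp
  qed
qed

text \<open>At the first difference of \<open>v\<close> and \<open>w\<close>, the letter of \<open>v\<close> is smaller and occurs later in \<open>w\<close>, so
  \<open>w\<close> has a descent in between; swapping it only loses one set, which no initial segment of \<open>v\<close> equals.\<close>

lemma lexicographic_exchange:
  fixes f :: "'a \<Rightarrow> 'l::linorder"
  assumes v: "distinct v" "set v = S" and w: "distinct w" "set w = S"
    and f: "inj_on f S" and less: "map f v < map f w"
  shows "\<exists>u A. distinct u \<and> set u = S \<and> map f u < map f w \<and> A \<in> flag S (singletons w) \<and>
    A \<notin> flag S (singletons v) \<and> flag S (singletons w) - {A} \<subseteq> flag S (singletons u)"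
proof -
  \<comment> \<open>Equal lengths exclude the case of the lexicographic order in which
    \<open>v\<close> is a proper prefix.\<close>
  have "length v = length w"
    using v w distinct_card by metis
  then have "map f w \<noteq> map f v @ c # xs" for c xs
    by (auto dest!: arg_cong[where f = length])
  moreover have "(\<exists>c xs. map f w = map f v @ c # xs) \<or>
      (\<exists>xs b a ys zs. b < a \<and> map f v = xs @ b # ys \<and> map f w = xs @ a # zs)"
    using less unfolding list_less_def lexord_def by simp
  ultimately obtain xs b' a' ys zs where *: "b' < a'" "map f v = xs @ b' # ys" "map f w = xs @ a' # zs"
    by blast
  then obtain pre b v' where v': "v = pre @ b # v'" "map f pre = xs" "f b = b'"
    by (auto simp: map_eq_append_conv map_eq_Cons_conv)
  obtain pre' a w' where w': "w = pre' @ a # w'" "map f pre' = xs" "f a = a'"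
    using * by (auto simp: map_eq_append_conv map_eq_Cons_conv)
  \<comment> \<open>The first difference is found among the values; injectivity of \<open>f\<close>
    turns the common prefix of values into a common prefix of letters.\<close>
  have "map f pre = map f pre'"
    using v' w' by simp
  moreover have "inj_on f (set pre \<union> set pre')"
    by (rule inj_on_subset[OF f]) (use v v' w w' in auto)
  ultimately have "pre' = pre"
    by (auto dest: map_inj_on)
  have "b \<in> set w'"
    using v w v' w' \<open>pre' = pre\<close> * by (auto simp: set_eq_iff)
  then obtain ys' zs' where w'': "w' = ys' @ b # zs'"
    by (meson split_list)
  obtain xs1 c d zs1 where dec: "a # ys' @ [b] = xs1 @ c # d # zs1" "f d < f c"
    using descent_exists[of f b a ys'] * v' w' by auto
  define P where "P = pre @ xs1"
  define R where "R = zs1 @ zs'"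
  have w_eq: "w = P @ c # d # R"
  proof -
    have "w = pre @ (a # ys' @ [b]) @ zs'"
      using w' w'' \<open>pre' = pre\<close> by simp
    then show ?thesis
      unfolding dec(1) by (simp add: P_def R_def)
  qed
  \<comment> \<open>The descent separates \<open>a\<close> from \<open>b\<close>: \<open>a\<close>
    is at or before \<open>c\<close>, and \<open>b\<close> is at or after \<open>d\<close>.\<close>
  have "a \<in> set (xs1 @ [c])"
    using dec(1) by (cases xs1) auto
  moreover have "b \<in> set (d # zs1)"
    using arg_cong[OF dec(1), of last] by (auto split: if_splits)
  ultimately have a: "a \<in> set (P @ [c])" and b: "b \<notin> set (P @ [c])"
    using w(1) unfolding w_eq P_def R_def by auto
  define u where "u = P @ d # c # R"
  \<comment> \<open>The initial segment that ends between \<open>c\<close> and \<open>d\<close> is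
    the only one whose set changes under the swap.\<close>
  define A where "A = set (P @ [c])"
  have "distinct u" "set u = S"
    using w unfolding w_eq u_def by auto
  moreover have "map f u < map f w"
    using dec(2) by (auto simp: list_less_def u_def w_eq intro!: lexord_append_leftI)
  moreover have "d \<in> S" "d \<notin> A"
    using w unfolding w_eq A_def by auto
  then have "A \<in> flag S (singletons w)"
    by (auto simp: flag_def w_eq initial_unions_append A_def)
  moreover have "A \<notin> flag S (singletons v)"
  proof
    \<comment> \<open>In \<open>v\<close> the letter \<open>b\<close> directly follows
      \<open>pre\<close> while \<open>a\<close> comes later, so an initial segment containing
      \<open>a\<close> also contains \<open>b\<close>.\<close>
    assume "A \<in> flag S (singletons v)"
    then obtain g q where g: "singletons v = g @ q" "A = {} \<union> \<Union>(set g)"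
      unfolding flag_def by (blast elim: initial_unions_split)
    then obtain v1 v2 where v12: "v = v1 @ v2" "g = singletons v1"
      by (auto simp: map_eq_append_conv)
    then have "A = set v1"
      using g by auto
    then have "a \<in> set v1" "b \<notin> set v1"
      using a b unfolding A_def by auto
    moreover have "a \<notin> set pre"
      using w(1) w' \<open>pre' = pre\<close> by auto
    ultimately show False
      using v12 v' by (auto simp: append_eq_append_conv2 append_eq_Cons_conv Cons_eq_append_conv)
  qed
  moreover have "flag S (singletons w) - {A} \<subseteq> flag S (singletons u)"
    by (auto simp: flag_def w_eq u_def A_def initial_unions_append insert_commute)
  ultimately show ?thesis
    by blast
qed

lemma finite_sorted_list_exists:
  fixes key :: "'b \<Rightarrow> 'l::linorder"
  assumes "finite A" "inj_on key A"
  obtains xs where "set xs = A" "distinct xs" "sorted_wrt (\<lambda>x y. key x < key y) xs"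
proof
  let ?ks = "sorted_list_of_set (key ` A)" and ?g = "inv_into A key"
  have set: "set ?ks = key ` A"
    using assms(1) by simp
  show "set (map ?g ?ks) = A"
    using set assms(2) by (simp add: inv_into_image_cancel)
  show "distinct (map ?g ?ks)"
    using set by (simp add: distinct_map inj_on_inv_into)
  show "sorted_wrt (\<lambda>x y. key x < key y) (map ?g ?ks)"
    unfolding sorted_wrt_map
    by (rule sorted_wrt_mono_rel[OF _ strict_sorted_list_of_set])
      (use set in \<open>auto simp: f_inv_into_f\<close>)
qed

lemma finite_set_compositions: "finite S \<Longrightarrow> finite (set_compositions S)"
proof -
  assume "finite S"
  then have "finite {p. set p \<subseteq> Pow S \<and> distinct p}"
    by (intro finite_subset_distinct) simp
  moreover have "set_compositions S \<subseteq> {p. set p \<subseteq> Pow S \<and> distinct p}"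
    by (auto simp: set_compositions_def partition_on_def)
  ultimately show ?thesis
    by (rule rev_finite_subset)
qed

lemma set_compositions_shellable:
  assumes "finite S" "S \<noteq> {}"
  obtains fs where "shellable_complex (set_compositions S) (flag S) (card S - 1) fs"
proof -
  \<comment> \<open>The points of \<open>S\<close> carry no order; an injection into the naturals
    supplies one for comparing words.\<close>
  obtain f :: "'a \<Rightarrow> nat" where f: "inj_on f S"
    using finite_imp_inj_to_nat_seg[OF assms(1)] by blast
  let ?W = "{w. distinct w \<and> set w = S}"
  have "finite ?W"
    by (rule finite_subset[OF _ finite_subset_distinct[OF assms(1)]]) auto
  moreover have "inj_on (map f) ?W"
    by (rule inj_onI) (use f in \<open>auto dest!: map_inj_on\<close>)
  ultimately obtain ws where ws: "set ws = ?W" "distinct ws" "sorted_wrt (\<lambda>v w. map f v < map f w) ws"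
    by (rule finite_sorted_list_exists)
  have length: "length w = card S" if "w \<in> ?W" for w
    using that distinct_card[of w] by auto
  have card_S: "0 < card S"
    using assms by (simp add: card_gt_0_iff)
  have refine: "\<exists>w\<in>?W. merges_to (singletons w) p" if "p \<in> set_compositions S" for p
    using refine_to_singletons[of "{}" p] that assms(1) by (auto simp: set_compositions_iff)
  \<comment> \<open>A linear ordering of \<open>S\<close> has \<open>card S\<close> initial unions,
    of which the last is \<open>S\<close> itself; hence facets have \<open>card S - 1\<close>
    vertices.\<close>
  have "shellable_complex (set_compositions S) (flag S) (card S - 1) (map singletons ws)"
  proof
    show "set_compositions S \<noteq> {}"
      using finite_distinct_list[OF assms(1)] singletons_in_set_compositions by blast
    show "inj_on (flag S) (set_compositions S)"
      by (rule flag_inj[OF assms(2)])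
    show "finite (flag S p)" if "p \<in> set_compositions S" for p
      by (rule card_flag[OF assms(2) that])
    show "\<exists>q\<in>set_compositions S. flag S q = A" if "p \<in> set_compositions S" "A \<subseteq> flag S p" for p A
      by (rule subset_flag[OF assms(2) that])
    show "\<exists>q\<in>set_compositions S. flag S p \<subseteq> flag S q \<and> card (flag S q) = card S - 1"
      if p: "p \<in> set_compositions S" for p
    proof -
      obtain w where w: "w \<in> ?W" "merges_to (singletons w) p"
        using refine[OF p] by blast
      then have q: "singletons w \<in> set_compositions S"
        by (simp add: singletons_in_set_compositions)
      moreover have "flag S p \<subseteq> flag S (singletons w)"
        using w(2) merges_to_iff_flag[OF assms(2) p q] by blast
      moreover have "card (flag S (singletons w)) = card S - 1"
        using card_flag(2)[OF assms(2) q] length[OF w(1)] by simp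
      ultimately show ?thesis
        by blast
    qed
    show "distinct (map singletons ws)"
      using ws(2) by (auto simp: distinct_map intro!: inj_onI)
    show "set (map singletons ws) = {p \<in> set_compositions S. card (flag S p) = card S - 1}"
    proof (intro equalityI subsetI)
      fix p assume "p \<in> set (map singletons ws)"
      then obtain w where w: "p = singletons w" "w \<in> ?W"
        using ws(1) by auto
      then have p: "p \<in> set_compositions S"
        by (simp add: singletons_in_set_compositions)
      show "p \<in> {p \<in> set_compositions S. card (flag S p) = card S - 1}"
        using card_flag(2)[OF assms(2) p] p length[OF w(2)] w(1) by simp
    next
      fix p assume "p \<in> {p \<in> set_compositions S. card (flag S p) = card S - 1}"
      then have p: "p \<in> set_compositions S" and "card (flag S p) = card S - 1"
        by auto
      then have "length p = card S"
        using card_flag(2)[OF assms(2) p] card_S by simp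
      moreover obtain w where w: "w \<in> ?W" "merges_to (singletons w) p"
        using refine[OF p] by blast
      \<comment> \<open>A composition with \<open>card S\<close> blocks is as long as its refinement
        into singletons, so the merging is trivial.\<close>
      ultimately have "p = singletons w"
        using merges_to_length(2)[OF w(2)] length[OF w(1)] by simp
      then show "p \<in> set (map singletons ws)"
        using w ws(1) by auto
    qed
    show "\<exists>l<j. \<exists>a\<in>flag S (map singletons ws ! j). a \<notin> flag S (map singletons ws ! i) \<and>
        flag S (map singletons ws ! j) - {a} \<subseteq> flag S (map singletons ws ! l)"
      if "j < length (map singletons ws)" "i < j" for i j
    proof -
      have j: "j < length ws"
        using that by simp
      have W: "ws ! k \<in> ?W" if "k < length ws" for k
        using ws(1) that nth_mem by blast
      have "map f (ws ! i) < map f (ws ! j)"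
        using sorted_wrt_nth_less[OF ws(3) that(2) j] .
      then obtain u A where u: "distinct u" "set u = S" "map f u < map f (ws ! j)"
        "A \<in> flag S (singletons (ws ! j))" "A \<notin> flag S (singletons (ws ! i))"
        "flag S (singletons (ws ! j)) - {A} \<subseteq> flag S (singletons u)"
        using lexicographic_exchange[of "ws ! i" S "ws ! j" f] W[OF j] W[of i] \<open>i < j\<close> j f by auto
      then obtain l where l: "l < length ws" "ws ! l = u"
        using ws(1) by (metis (mono_tags, lifting) in_set_conv_nth mem_Collect_eq)
      \<comment> \<open>The words are listed in increasing order, so the smaller word
        \<open>u\<close> stands earlier.\<close>
      have "l < j"
      proof (rule ccontr)
        assume "\<not> l < j"
        then have "l = j \<or> j < l"
          by auto
        then show False
          using sorted_wrt_nth_less[OF ws(3) _ l(1), of j] u(3) l(2) by (auto dest: less_asym)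
      qed
      then show ?thesis
        using u(4-6) l j \<open>i < j\<close> by (intro exI[of _ l] conjI bexI[of _ A]) simp_all
    qed
  qed
  then show ?thesis
    by (rule that)
qed

theorem proposition4p9:
  fixes S :: "'a set"
  assumes "finite S" and "S \<noteq> {}"
  shows "admits_recursive_atom_ordering ((AsPi_plus S)\<inverse>) \<and>
         cohen_macaulay TYPE('k::comm_ring_1) (AsPi_plus S)"
proof -
  obtain fs where "shellable_complex (set_compositions S) (flag S) (card S - 1) fs"
    using assms by (rule set_compositions_shellable)
  then interpret shellable_complex "set_compositions S" "flag S" "card S - 1" fs .
  have "AsPi S = {(p, q). p \<in> set_compositions S \<and> q \<in> set_compositions S \<and> flag S p \<subseteq> flag S q}"
    unfolding AsPi_def using merges_to_iff_flag[OF assms(2)] by blast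
  then have "(AsPi_plus S)\<inverse> = dual_order"
    by (simp add: AsPi_plus_def dual_order_def)
  moreover from this have "AsPi_plus S = dual_order\<inverse>"
    by auto
  ultimately show ?thesis
    using recursive_atom_ordering_dual_order dual_order_cohen_macaulay[OF finite_set_compositions[OF assms(1)]]
    by (auto simp: admits_recursive_atom_ordering_def)
qed

end
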